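(* Let $\epsilon>0$ and $\alpha,\beta>0$, and suppose there are continuous functions $f,g\colon[0,1]\to(0,\infty)$ with $\sup_{x\in[0,1]}\frac{\mathcal L_\epsilon g(x)}{g(x)}\le e^{-\alpha}$ and $\sup_{x\in[0,1]}\frac{\mathcal L_{-\epsilon}f(x)}{f(x)}\le e^{\beta}$. Then $\dfrac{\beta}{\epsilon}\ge h(\mu)\ge\dfrac{\alpha}{\epsilon}$.
   Context: Let $T_i(x)=\sqrt{i+x}-1$, $i=1,2,3$, be the inverse branches $[0,1]\to[0,1]$ of the Bolyai–Rényi map $T$ (given by $T(x)=x^2+2x-(i-1)$ on $[0,\sqrt2-1)$, $[\sqrt2-1,\sqrt3-1)$, $[\sqrt3-1,1)$ respectively). Let $\mu$ be the unique $T$-invariant probability measure absolutely continuous w.r.t. Lebesgue, and $h(\mu)$ its metric entropy. For $t\in\mathbb R$ define $\mathcal L_t\colon C([0,1])\to C([0,1])$ by $\mathcal L_tf(x)=\sum_{i=1}^3|T_i'(x)|^{1+t}f(T_ix)$. *)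

theory Defs
  imports "HOL-Probability.Probability"
begin

definition bolyai_inv :: "nat \<Rightarrow> real \<Rightarrow> real" where
  "bolyai_inv i x = sqrt (real i + x) - 1"

text \<open>The Bolyai-Renyi map on [0,1]; at the point 1 the third branch is used
  (T 1 = 1), a Lebesgue-null convention.\<close>
definition bolyai_T :: "real \<Rightarrow> real" where
  "bolyai_T x = (if x < sqrt 2 - 1 then x^2 + 2*x
                 else if x < sqrt 3 - 1 then x^2 + 2*x - 1
                 else x^2 + 2*x - 2)"

definition leb01 :: "real measure" where
  "leb01 = restrict_space lborel {0..1}"

definition acim :: "real measure \<Rightarrow> bool" where
  "acim M \<longleftrightarrow> sets M = sets leb01 \<and> prob_space M \<and>
     bolyai_T \<in> measurable M M \<and> distr M M bolyai_T = M \<and>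
     absolutely_continuous leb01 M"

definition bolyai_mu :: "real measure" where
  "bolyai_mu = (THE M. acim M)"

definition ent_phi :: "real \<Rightarrow> real" where
  "ent_phi t = (if t = 0 then 0 else - t * ln t)"

definition finite_meas_partition :: "'a measure \<Rightarrow> 'a set set \<Rightarrow> bool" where
  "finite_meas_partition M P \<longleftrightarrow> finite P \<and> P \<subseteq> sets M \<and> disjoint P \<and> \<Union>P = space M"

definition partition_entropy :: "'a measure \<Rightarrow> 'a set set \<Rightarrow> real" where
  "partition_entropy M P = (\<Sum>A\<in>P. ent_phi (measure M A))"

definition iter_join :: "'a measure \<Rightarrow> ('a \<Rightarrow> 'a) \<Rightarrow> 'a set set \<Rightarrow> nat \<Rightarrow> 'a set set" where
  "iter_join M T P n = {A. A \<noteq> {} \<and> (\<exists>c. (\<forall>k<n. c k \<in> P) \<and>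
       A = space M \<inter> (\<Inter>k\<in>{..<n}. (T ^^ k) -` c k))}"

definition partition_ks_entropy :: "'a measure \<Rightarrow> ('a \<Rightarrow> 'a) \<Rightarrow> 'a set set \<Rightarrow> real" where
  "partition_ks_entropy M T P = lim (\<lambda>n. partition_entropy M (iter_join M T P (Suc n)) / real (Suc n))"

definition ks_entropy :: "'a measure \<Rightarrow> ('a \<Rightarrow> 'a) \<Rightarrow> ereal" where
  "ks_entropy M T = (SUP P\<in>{P. finite_meas_partition M P}. ereal (partition_ks_entropy M T P))"

definition transfer_op :: "real \<Rightarrow> (real \<Rightarrow> real) \<Rightarrow> real \<Rightarrow> real" where
  "transfer_op t f x = (\<Sum>i\<in>{1,2,3}. \<bar>deriv (bolyai_inv i) x\<bar> powr (1 + t) * f (bolyai_inv i x))"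

end

theory Submission
  imports Defs
begin

text \<open>
  The transfer operator \<open>\<L>\<^sub>0\<close> maps densities \<open>f\<close> with \<open>f x \<le> exp (K * \<bar>x - y\<bar>) * f y\<close> for \<open>K = 2\<close> to such
  densities for \<open>K = 3/2\<close>, so a fixed multiple of \<open>1\<close> can be split off and its iterates contract
  exponentially. The limit is the density of an invariant measure \<open>\<mu>\<close>; exponential contraction also gives
  Lebesgue mixing with limit \<open>\<mu>\<close>, hence uniqueness. By bounded distortion the \<open>\<mu>\<close>-measure of a cylinder of
  order \<open>n\<close> is comparable to the derivative \<open>J w\<close> of its inverse branch, and iterating the hypothesis
  \<open>\<L>\<^sub>t g \<le> \<kappa> g\<close> bounds \<open>\<Sum>w. J w powr (1 + t)\<close> by a multiple of \<open>\<kappa> ^ n\<close>. Jensen's inequality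
  turns this into \<open>- t * H n \<le> n * ln \<kappa> + O(1)\<close> for the entropy \<open>H n\<close> of the partition into
  cylinders; \<open>t = \<epsilon>\<close> gives the lower and \<open>t = - \<epsilon>\<close> the upper bound, the latter for all partitions because
  cylinders generate.
\<close>

section \<open>Entropy of simple random variables\<close>

text \<open>Two definitions shape the argument. \<open>bolyai_mu\<close> is a definite description,
  so nothing can be said about it before existence and uniqueness are both proved; uniqueness must
  cover competitors whose density is merely integrable and need not lie in any cone.
  \<open>partition_ks_entropy\<close> is a \<open>lim\<close>, so subadditivity has to give
  convergence before any estimate passes to the limit. The estimate on word entropies concerns a
  single partition. That suffices for the lower bound, since \<open>ks_entropy\<close> is a
  supremum. The upper bound concerns every finite partition: its cells are approximated in measure
  by unions of cylinders of one large order, and the entropy left over given those cylinders is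
  shown to be small by finite sums alone. The functions \<open>f\<close> and \<open>g\<close> need
  not be eigenfunctions: each has a positive minimum on [0,1], so inserting it into a sum over words
  costs a constant factor, which the average over \<open>n\<close> removes.\<close>

context prob_space
begin

definition pr :: "('a \<Rightarrow> 'b) \<Rightarrow> 'b \<Rightarrow> real" where
  "pr X v = prob (X -` {v} \<inter> space M)"

text \<open>Partitions are represented by the fibres of a simple function: a join becomes a pairing,
  a coarsening becomes a composition, and a shift in time becomes composition with the
  dynamics.\<close>

definition ent :: "('a \<Rightarrow> 'b) \<Rightarrow> real" where
  "ent X = (\<Sum>v\<in>X ` space M. ent_phi (pr X v))"

lemma pr_nonneg [simp]: "0 \<le> pr X v" and pr_le_1: "pr X v \<le> 1"
  by (simp_all add: pr_def)

lemma simple_function_comp_arg: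
  assumes "simple_function M X" shows "simple_function M (\<lambda>x. f (X x))"
  using simple_function_compose[OF assms, of f] by (simp add: comp_def)

lemma prob_simple_function:
  assumes W: "simple_function M W"
  shows "prob {x \<in> space M. P (W x)} = (\<Sum>w | w \<in> W ` space M \<and> P w. pr W w)"
proof -
  have fin: "finite {w \<in> W ` space M. P w}"
    using simple_functionD(1)[OF W] by simp
  have eq: "{x \<in> space M. P (W x)} = (\<Union>w\<in>{w \<in> W ` space M. P w}. W -` {w} \<inter> space M)"
    by auto
  show ?thesis
    unfolding eq pr_def
    by (rule finite_measure_finite_Union[OF fin])
       (use simple_functionD(2)[OF W] in \<open>auto simp: disjoint_family_on_def\<close>)
qed

lemma sum_pr:
  assumes "simple_function M W" shows "(\<Sum>w\<in>W ` space M. pr W w) = 1"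
  using prob_simple_function[OF assms, of "\<lambda>_. True"] prob_space by simp

lemma pr_comp_eq_sum:
  assumes "simple_function M W"
  shows "pr (\<lambda>x. g (W x)) v = (\<Sum>w | w \<in> W ` space M \<and> g w = v. pr W w)"
proof -
  have "(\<lambda>x. g (W x)) -` {v} \<inter> space M = {x \<in> space M. g (W x) = v}" by auto
  then show ?thesis using prob_simple_function[OF assms, of "\<lambda>w. g w = v"] by (simp add: pr_def)
qed

lemma pr_le_pr_comp:
  assumes W: "simple_function M W" shows "pr W w \<le> pr (\<lambda>x. g (W x)) (g w)"
  unfolding pr_def
  by (rule finite_measure_mono)
     (use simple_functionD(2)[OF simple_function_comp_arg[OF W, of g]] in auto)

lemma pr_eq_0:
  assumes "v \<notin> X ` space M" shows "pr X v = 0"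
proof -
  have "X -` {v} \<inter> space M = {}" using assms by auto
  then show ?thesis by (simp add: pr_def)
qed

lemma ent_superset:
  assumes "finite S" "X ` space M \<subseteq> S"
  shows "ent X = (\<Sum>v\<in>S. ent_phi (pr X v))"
  unfolding ent_def
  by (rule sum.mono_neutral_left) (use assms in \<open>auto simp: pr_eq_0 ent_phi_def\<close>)

text \<open>Grouping the values of \<open>W\<close> by their image spreads the entropy of a coarser
  variable over the values of one common fine variable, so that entropies of different coarsenings
  can be compared term by term.\<close>

lemma ent_comp_eq:
  assumes W: "simple_function M W"
  shows "ent (\<lambda>x. g (W x)) = (\<Sum>w\<in>W ` space M. - pr W w * ln (pr (\<lambda>x. g (W x)) (g w)))"
proof -
  let ?Z = "\<lambda>x. g (W x)"
  have fin: "finite (W ` space M)" using simple_functionD(1)[OF W] .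
  have "ent ?Z = (\<Sum>v\<in>g ` W ` space M. - pr ?Z v * ln (pr ?Z v))"
    unfolding ent_def image_image by (rule sum.cong) (auto simp: ent_phi_def)
  also have "\<dots> = (\<Sum>v\<in>g ` W ` space M. \<Sum>w | w \<in> W ` space M \<and> g w = v. - pr W w * ln (pr ?Z (g w)))"
    by (rule sum.cong) (auto simp: pr_comp_eq_sum[OF W] sum_distrib_right sum_negf)
  also have "\<dots> = (\<Sum>w\<in>W ` space M. - pr W w * ln (pr ?Z (g w)))"
    using sum.image_gen[OF fin, of "\<lambda>w. - pr W w * ln (pr ?Z (g w))" g] by simp
  finally show ?thesis .
qed

text \<open>Coarsening can only enlarge the probability of the observed value, hence lowers its
  information \<open>- ln\<close>, term by term in \<open>ent_comp_eq\<close>.\<close>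

lemma ent_comp_le:
  assumes W: "simple_function M W"
  shows "ent (\<lambda>x. g (W x)) \<le> ent W"
proof -
  have "ent W = (\<Sum>w\<in>W ` space M. - pr W w * ln (pr W w))"
    using ent_comp_eq[OF W, of "\<lambda>x. x"] by simp
  moreover have "- pr W w * ln (pr (\<lambda>x. g (W x)) (g w)) \<le> - pr W w * ln (pr W w)" for w
  proof (cases "pr W w = 0")
    case False
    then have "ln (pr W w) \<le> ln (pr (\<lambda>x. g (W x)) (g w))"
      using pr_nonneg[of W w] pr_le_pr_comp[OF W, of w g] by (intro ln_mono) linarith+
    then show ?thesis by (simp add: mult_left_mono)
  qed simp
  ultimately show ?thesis by (simp only: ent_comp_eq[OF W] sum_mono)
qed

lemma ent_le_of_comp:
  assumes W: "simple_function M W" and eq: "\<And>x. x \<in> space M \<Longrightarrow> V x = g (W x)"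
  shows "ent V \<le> ent W"
proof -
  have "ent V = ent (\<lambda>x. g (W x))"
    unfolding ent_def pr_def
    by (rule sum.cong) (auto simp: eq intro!: arg_cong[where f=ent_phi] arg_cong[where f=prob])
  then show ?thesis using ent_comp_le[OF W, of g] by simp
qed

text \<open>Conditioning on the finer variable \<open>Y\<close> leaves less entropy in \<open>X\<close> than conditioning on \<open>f \<circ> Y\<close>;
  writing this without conditional entropies avoids division by probabilities that may vanish.\<close>
lemma ent_submodular:
  assumes X: "simple_function M X" and Y: "simple_function M Y"
  shows "ent (\<lambda>x. (X x, Y x)) + ent (\<lambda>x. f (Y x)) \<le> ent (\<lambda>x. (X x, f (Y x))) + ent Y"
proof -
  define W where "W = (\<lambda>x. (X x, Y x))"
  have W: "simple_function M W" unfolding W_def using X Y by (rule simple_function_Pair)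
  let ?XZ = "\<lambda>x. (X x, f (Y x))" let ?Z = "\<lambda>x. f (Y x)"
  have Z: "simple_function M ?Z" by (rule simple_function_comp_arg[OF Y])
  have XZ: "simple_function M ?XZ" using X Z by (rule simple_function_Pair)
  note fin = simple_functionD(1)[OF X] simple_functionD(1)[OF Y] simple_functionD(1)[OF W]
  have e1: "ent W = (\<Sum>w\<in>W ` space M. - pr W w * ln (pr W w))"
    using ent_comp_eq[OF W, of "\<lambda>w. w"] by simp
  have e2: "ent ?Z = (\<Sum>w\<in>W ` space M. - pr W w * ln (pr ?Z (f (snd w))))"
    using ent_comp_eq[OF W, of "\<lambda>w. f (snd w)"] by (simp add: W_def)
  have e3: "ent ?XZ = (\<Sum>w\<in>W ` space M. - pr W w * ln (pr ?XZ (fst w, f (snd w))))"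
    using ent_comp_eq[OF W, of "\<lambda>w. (fst w, f (snd w))"] by (simp add: W_def)
  have e4: "ent Y = (\<Sum>w\<in>W ` space M. - pr W w * ln (pr Y (snd w)))"
    using ent_comp_eq[OF W, of snd] by (simp add: W_def)
  \<comment> \<open>\<open>?r\<close> is the joint law that would make \<open>X\<close> and
    \<open>Y\<close> conditionally independent given \<open>f \<circ> Y\<close>. The claim is the
    nonnegativity of the relative entropy of \<open>pr W\<close> with respect to it: by
    \<open>ln u \<le> u - 1\<close> it remains to see that \<open>?r\<close> has total mass at most
    1.\<close>
  let ?r = "\<lambda>w. pr ?XZ (fst w, f (snd w)) * pr Y (snd w) / pr ?Z (f (snd w))"
  have summand: "- pr W w * ln (pr W w) - pr W w * ln (pr ?Z (f (snd w)))
     + pr W w * ln (pr ?XZ (fst w, f (snd w))) + pr W w * ln (pr Y (snd w)) \<le> ?r w - pr W w" for w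
  proof (cases "pr W w = 0")
    case False
    then have p: "pr W w > 0" using pr_nonneg[of W w] by linarith
    have q1: "pr ?Z (f (snd w)) > 0" using pr_le_pr_comp[OF W, of w "\<lambda>w. f (snd w)"] p by (simp add: W_def)
    have q2: "pr ?XZ (fst w, f (snd w)) > 0"
      using pr_le_pr_comp[OF W, of w "\<lambda>w. (fst w, f (snd w))"] p by (simp add: W_def)
    have q3: "pr Y (snd w) > 0" using pr_le_pr_comp[OF W, of w snd] p by (simp add: W_def)
    have "pr W w * ln (?r w / pr W w) \<le> pr W w * (?r w / pr W w - 1)"
      using p q1 q2 q3 by (intro mult_left_mono ln_le_minus_one) auto
    also have "\<dots> = ?r w - pr W w" using p by (simp add: right_diff_distrib)
    also have "ln (?r w / pr W w) = ln (pr ?XZ (fst w, f (snd w))) + ln (pr Y (snd w))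
       - ln (pr ?Z (f (snd w))) - ln (pr W w)"
      using p q1 q2 q3 by (simp add: ln_div ln_mult)
    finally show ?thesis by (simp add: distrib_left right_diff_distrib)
  qed simp
  have "(\<Sum>w\<in>W ` space M. ?r w) \<le> (\<Sum>w\<in>X ` space M \<times> Y ` space M. ?r w)"
    by (rule sum_mono2) (use fin in \<open>auto simp: W_def intro!: divide_nonneg_nonneg mult_nonneg_nonneg\<close>)
  also have "\<dots> = (\<Sum>y\<in>Y ` space M. \<Sum>x\<in>X ` space M. pr ?XZ (x, f y) * pr Y y / pr ?Z (f y))"
    by (subst sum.swap) (simp add: sum.cartesian_product split_beta)
  \<comment> \<open>Summing over all \<open>x\<close> cancels the denominator when it is positive;
    when it is 0 the quotient is 0 as well, since \<open>a / 0 = 0\<close>, and the inequality still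
    holds.\<close>
  also have "\<dots> \<le> (\<Sum>y\<in>Y ` space M. pr Y y)"
  proof (rule sum_mono)
    fix y
    have "(\<Sum>x\<in>X ` space M. pr ?XZ (x, f y)) = (\<Sum>w | w \<in> X ` space M \<times> ?Z ` space M \<and> snd w = f y. pr ?XZ w)"
      if "f y \<in> ?Z ` space M"
      by (rule sum.reindex_bij_witness[where i=fst and j="\<lambda>x. (x, f y)"]) (use that in auto)
    also have "\<dots> = (\<Sum>w | w \<in> ?XZ ` space M \<and> snd w = f y. pr ?XZ w)"
    proof (rule sum.mono_neutral_right)
      show "\<forall>w\<in>{w \<in> X ` space M \<times> ?Z ` space M. snd w = f y} - {w \<in> ?XZ ` space M. snd w = f y}. pr ?XZ w = 0"
        using pr_eq_0[of _ ?XZ] by blast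
    qed (use fin(1) simple_functionD(1)[OF Z] in auto)
    also have "\<dots> = pr ?Z (f y)"
      using pr_comp_eq_sum[OF XZ, of snd "f y"] by simp
    finally have s: "f y \<in> ?Z ` space M \<Longrightarrow> (\<Sum>x\<in>X ` space M. pr ?XZ (x, f y)) = pr ?Z (f y)" by simp
    show "(\<Sum>x\<in>X ` space M. pr ?XZ (x, f y) * pr Y y / pr ?Z (f y)) \<le> pr Y y"
    proof (cases "pr ?Z (f y) = 0")
      case False
      then have "f y \<in> ?Z ` space M" using pr_eq_0[of "f y" ?Z] by blast
      with s False show ?thesis
        by (simp add: sum_distrib_right[symmetric] sum_divide_distrib[symmetric])
    qed simp
  qed
  also have "\<dots> = (\<Sum>w\<in>W ` space M. pr W w)" using sum_pr[OF Y] sum_pr[OF W] by simp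
  finally have "(\<Sum>w\<in>W ` space M. ?r w - pr W w) \<le> 0" by (simp add: sum_subtractf)
  moreover have "(\<Sum>w\<in>W ` space M. - pr W w * ln (pr W w) - pr W w * ln (pr ?Z (f (snd w)))
     + pr W w * ln (pr ?XZ (fst w, f (snd w))) + pr W w * ln (pr Y (snd w))) \<le> (\<Sum>w\<in>W ` space M. ?r w - pr W w)"
    by (intro sum_mono summand)
  ultimately have "ent W + ent ?Z \<le> ent ?XZ + ent Y"
    unfolding e1 e2 e3 e4 by (simp add: sum.distrib sum_subtractf sum_negf)
  then show ?thesis by (simp add: W_def)
qed

lemma ent_const [simp]: "ent (\<lambda>_. c) = 0"
proof -
  have "pr (\<lambda>_. c) c = 1" by (simp add: pr_def prob_space)
  then show ?thesis using not_empty by (simp add: ent_def ent_phi_def image_constant_conv)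
qed

text \<open>The case of \<open>ent_submodular\<close> in which nothing of \<open>Y\<close> is
  retained.\<close>

lemma ent_subadditive:
  assumes "simple_function M X" "simple_function M Y"
  shows "ent (\<lambda>x. (X x, Y x)) \<le> ent X + ent Y"
proof -
  have "ent (\<lambda>x. (X x, ())) \<le> ent X" by (rule ent_le_of_comp[OF assms(1), where g="\<lambda>x. (x, ())"]) simp
  then show ?thesis using ent_submodular[OF assms, of "\<lambda>_. ()"] by simp
qed

lemma ent_phi_nonneg: "0 \<le> t \<Longrightarrow> t \<le> 1 \<Longrightarrow> 0 \<le> ent_phi t"
  by (auto simp: ent_phi_def mult_nonneg_nonpos)

lemma ent_nonneg: "0 \<le> ent X"
  unfolding ent_def by (intro sum_nonneg ent_phi_nonneg pr_nonneg pr_le_1)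

text \<open>With \<open>p = P(X = a, Y = y)\<close> and \<open>q = P(Y = y)\<close>, the summand \<open>p * ln (q / p)\<close> of the conditional entropy is
  at most \<open>q - p\<close>, which is used for \<open>y \<in> W a\<close>, and at most \<open>2 * sqrt (p * q) \<le> \<eta> * q + p / \<eta>\<close>, used otherwise.\<close>
lemma ent_pair_le_of_approx:
  assumes X: "simple_function M X" and Y: "simple_function M Y" and \<eta>: "0 < \<eta>" "\<eta> \<le> 1"
    and A: "\<And>a. a \<in> X ` space M \<Longrightarrow> prob {x \<in> space M. (X x = a) \<noteq> (Y x \<in> W a)} \<le> \<eta>\<^sup>2"
  shows "ent (\<lambda>x. (X x, Y x)) \<le> ent Y + real (card (X ` space M)) * (3 * \<eta>)"
proof -
  define V where "V = (\<lambda>x. (X x, Y x))"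
  have V: "simple_function M V" unfolding V_def using X Y by (rule simple_function_Pair)
  note fin = simple_functionD(1)[OF X] simple_functionD(1)[OF Y] simple_functionD(1)[OF V]
  let ?S = "X ` space M \<times> Y ` space M"
  have prV: "pr V w = 0" if "w \<notin> V ` space M" for w by (rule pr_eq_0[OF that])
  have sup: "V ` space M \<subseteq> ?S" by (auto simp: V_def)
  have e1: "ent V = (\<Sum>w\<in>?S. - pr V w * ln (pr V w))"
    using ent_superset[OF _ sup] fin by (auto simp: ent_phi_def intro!: sum.cong)
  have e2: "ent Y = (\<Sum>w\<in>?S. - pr V w * ln (pr Y (snd w)))"
  proof -
    have "ent Y = (\<Sum>w\<in>V ` space M. - pr V w * ln (pr Y (snd w)))"
      using ent_comp_eq[OF V, of snd] by (simp add: V_def)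
    also have "\<dots> = (\<Sum>w\<in>?S. - pr V w * ln (pr Y (snd w)))"
      by (rule sum.mono_neutral_left) (use fin sup prV in auto)
    finally show ?thesis .
  qed
  have le: "pr V (a, y) \<le> pr Y y" for a y
    using pr_le_pr_comp[OF V, of "(a, y)" snd] by (simp add: V_def)
  have sqrt_bd: "- p * ln p + p * ln q \<le> \<eta> * q + p / \<eta>" if "0 < p" "p \<le> q" for p q :: real
  proof -
    have q: "q > 0" using that by simp
    have "ln (sqrt (q / p)) \<le> sqrt (q / p) - 1" using that q by (intro ln_le_minus_one) simp
    then have "ln (q / p) \<le> 2 * sqrt (q / p)" using that q by (simp add: ln_sqrt)
    then have "p * ln (q / p) \<le> p * (2 * sqrt (q / p))" using that by (intro mult_left_mono) auto
    also have "\<dots> = 2 * sqrt (\<eta> * q) * sqrt (p / \<eta>)"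
      using that q \<eta> by (simp add: real_sqrt_mult real_sqrt_divide field_simps)
    also have "\<dots> \<le> (sqrt (\<eta> * q))\<^sup>2 + (sqrt (p / \<eta>))\<^sup>2"
      using sum_squares_bound by blast
    also have "\<dots> = \<eta> * q + p / \<eta>" using that q \<eta> by simp
    finally show ?thesis using that q by (simp add: ln_div algebra_simps)
  qed
  have lin_bd: "- p * ln p + p * ln q \<le> q - p" if "0 < p" "p \<le> q" for p q :: real
  proof -
    have q: "q > 0" using that by simp
    have "p * ln (q / p) \<le> p * (q / p - 1)" using that q by (intro mult_left_mono ln_le_minus_one) auto
    also have "\<dots> = q - p" using that by (simp add: right_diff_distrib)
    finally show ?thesis using that q by (simp add: ln_div algebra_simps)
  qed
  let ?b = "\<lambda>(a, y). if y \<in> W a then pr Y y - pr V (a, y) else \<eta> * pr Y y + pr V (a, y) / \<eta>"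
  have summand: "- pr V w * ln (pr V w) + pr V w * ln (pr Y (snd w)) \<le> ?b w" for w
  proof (cases "pr V w = 0")
    case True
    then show ?thesis using \<eta> by (auto split: prod.split)
  next
    case False
    then have p: "pr V w > 0" using pr_nonneg[of V w] by linarith
    obtain a y where w: "w = (a, y)" by (cases w)
    show ?thesis using lin_bd[of "pr V (a,y)" "pr Y y"] sqrt_bd[of "pr V (a,y)" "pr Y y"] p le[of a y]
      unfolding w by (auto simp: w)
  qed
  have "ent V - ent Y = (\<Sum>w\<in>?S. - pr V w * ln (pr V w) + pr V w * ln (pr Y (snd w)))"
    unfolding e1 e2 by (simp add: sum.distrib sum_negf sum_subtractf)
  also have "\<dots> \<le> (\<Sum>w\<in>?S. ?b w)" by (intro sum_mono summand)
  also have "\<dots> = (\<Sum>a\<in>X ` space M. \<Sum>y\<in>Y ` space M. ?b (a, y))"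
    by (simp add: sum.cartesian_product)
  also have "\<dots> \<le> (\<Sum>a\<in>X ` space M. 3 * \<eta>)"
  proof (rule sum_mono)
    fix a assume a: "a \<in> X ` space M"
    let ?I = "{y \<in> Y ` space M. y \<in> W a}" let ?O = "{y \<in> Y ` space M. y \<notin> W a}"
    let ?D = "{x \<in> space M. (X x = a) \<noteq> (Y x \<in> W a)}"
    have D: "?D \<in> events"
      using simple_functionD(2)[OF V, of "{(b, y). (b = a) \<noteq> (y \<in> W a)}"]
      by (simp add: V_def vimage_def Int_def conj_commute)
    have Yin: "(\<Sum>y\<in>?I. pr Y y) = prob {x \<in> space M. Y x \<in> W a}"
      using prob_simple_function[OF Y, of "\<lambda>y. y \<in> W a"] by simp
    have Vin: "(\<Sum>y | y \<in> Y ` space M \<and> P y. pr V (a, y)) = prob {x \<in> space M. X x = a \<and> P (Y x)}" for P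
    proof -
      have "prob {x \<in> space M. X x = a \<and> P (Y x)} = (\<Sum>w | w \<in> V ` space M \<and> (fst w = a \<and> P (snd w)). pr V w)"
        using prob_simple_function[OF V, of "\<lambda>w. fst w = a \<and> P (snd w)"] by (simp add: V_def)
      also have "\<dots> = (\<Sum>w | w \<in> ?S \<and> (fst w = a \<and> P (snd w)). pr V w)"
        by (rule sum.mono_neutral_left) (use fin sup prV in auto)
      also have "\<dots> = (\<Sum>y | y \<in> Y ` space M \<and> P y. pr V (a, y))"
        by (rule sum.reindex_bij_witness[where j=snd and i="\<lambda>y. (a, y)"]) (use a in auto)
      finally show ?thesis by simp
    qed
    have ev: "{x \<in> space M. P (X x) (Y x)} \<in> events" for P
      using simple_functionD(2)[OF V, of "{(b, y). P b y}"]
      by (simp add: V_def vimage_def Int_def conj_commute)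
    have "prob {x \<in> space M. Y x \<in> W a} - prob {x \<in> space M. X x = a \<and> Y x \<in> W a}
        = prob ({x \<in> space M. Y x \<in> W a} - {x \<in> space M. X x = a \<and> Y x \<in> W a})"
      by (rule finite_measure_Diff[symmetric])
         (use ev[of "\<lambda>_ y. y \<in> W a"] ev[of "\<lambda>b y. b = a \<and> y \<in> W a"] in auto)
    also have "\<dots> \<le> prob ?D" by (rule finite_measure_mono[OF _ D]) auto
    finally have b1: "(\<Sum>y\<in>?I. pr Y y - pr V (a, y)) \<le> \<eta>\<^sup>2"
      using A[OF a] Yin Vin[of "\<lambda>y. y \<in> W a"] by (simp add: sum_subtractf)
    have "prob {x \<in> space M. X x = a \<and> Y x \<notin> W a} \<le> prob ?D" by (rule finite_measure_mono[OF _ D]) auto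
    then have b2: "(\<Sum>y\<in>?O. pr V (a, y)) \<le> \<eta>\<^sup>2"
      using A[OF a] Vin[of "\<lambda>y. y \<notin> W a"] by simp
    have b3: "(\<Sum>y\<in>?O. pr Y y) \<le> 1"
      using prob_simple_function[OF Y, of "\<lambda>y. y \<notin> W a"]
      prob_le_1[of "{x \<in> space M. Y x \<notin> W a}"] by linarith
    have "(\<Sum>y\<in>Y ` space M. ?b (a, y)) = (\<Sum>y\<in>?I. pr Y y - pr V (a, y)) + (\<Sum>y\<in>?O. \<eta> * pr Y y + pr V (a, y) / \<eta>)"
      using fin(2) by (simp add: sum.If_cases Int_def)
    also have "\<dots> = (\<Sum>y\<in>?I. pr Y y - pr V (a, y)) + (\<eta> * (\<Sum>y\<in>?O. pr Y y) + (\<Sum>y\<in>?O. pr V (a, y)) / \<eta>)"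
      by (simp add: sum.distrib sum_distrib_left sum_divide_distrib)
    \<comment> \<open>The approximation error is assumed to be a square so that the division by
      \<eta> still leaves a term of size \<eta>.\<close>
    also have "\<dots> \<le> \<eta>\<^sup>2 + (\<eta> * 1 + \<eta>\<^sup>2 / \<eta>)"
      using b1 b2 b3 \<eta> by (intro add_mono mult_left_mono divide_right_mono) auto
    also have "\<dots> \<le> 3 * \<eta>" using \<eta> by (simp add: power2_eq_square mult_left_le)
    finally show "(\<Sum>y\<in>Y ` space M. ?b (a, y)) \<le> 3 * \<eta>" .
  qed
  finally show ?thesis by (simp add: V_def)
qed

end

section \<open>Entropy of measure preserving maps\<close>

text \<open>Fekete's lemma: the quotients converge to their infimum. It gives meaning to the
  \<open>lim\<close> in \<open>partition_ks_entropy\<close>.\<close>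

lemma fekete_convergent:
  fixes a :: "nat \<Rightarrow> real"
  assumes nonneg: "\<And>n. 0 \<le> a n" and sub: "\<And>m n. a (m + n) \<le> a m + a n"
  shows "convergent (\<lambda>n. a (Suc n) / real (Suc n))"
proof -
  define l where "l = (INF n. a (Suc n) / real (Suc n))"
  have bdd: "bdd_below (range (\<lambda>n. a (Suc n) / real (Suc n)))"
    by (rule bdd_belowI[of _ 0]) (auto intro!: divide_nonneg_nonneg nonneg)
  have l_le: "l \<le> a (Suc n) / real (Suc n)" for n
    unfolding l_def by (rule cINF_lower[OF bdd]) simp
  have mult: "a (q * k) \<le> real q * a k" if "q > 0" for q k
    using that
  proof (induction q)
    case (Suc q)
    show ?case
    proof (cases "q = 0")
      case False
      then show ?thesis using Suc.IH sub[of k "q * k"] by (simp add: algebra_simps)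
    qed simp
  qed simp
  have "(\<lambda>n. a (Suc n) / real (Suc n)) \<longlonglongrightarrow> l"
  proof (rule LIMSEQ_I)
    fix e :: real assume e: "0 < e"
    obtain m where m: "a (Suc m) / real (Suc m) < l + e / 2"
      using cInf_lessD[of "range (\<lambda>n. a (Suc n) / real (Suc n))" "l + e / 2"] e
      unfolding l_def by auto
    define k where "k = Suc m"
    \<comment> \<open>A crude bound for all \<open>a r\<close> with \<open>r \<le> k\<close>; it
      absorbs the remainder in the division of \<open>s\<close> by \<open>k\<close> and disappears
      after division by \<open>s\<close>.\<close>
    define C where "C = (\<Sum>r<k. a r) + a k"
    have C: "a r \<le> C" if "r \<le> k" for r
    proof (cases "r = k")
      case False
      then have "a r \<le> (\<Sum>r<k. a r)" using that nonneg by (intro member_le_sum) auto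
      then show ?thesis using nonneg[of k] by (simp add: C_def)
    qed (simp add: C_def sum_nonneg nonneg)
    obtain N where N: "2 * C / e < real N" using reals_Archimedean2 by blast
    show "\<exists>no. \<forall>n\<ge>no. norm (a (Suc n) / real (Suc n) - l) < e"
    proof (intro exI allI impI)
      fix n assume n: "n \<ge> N + k"
      define s where "s = Suc n"
      have q: "s div k > 0" using n unfolding s_def k_def by (simp add: div_greater_zero_iff)
      have "a s \<le> a (s div k * k) + a (s mod k)" using sub[of "s div k * k" "s mod k"] by simp
      also have "\<dots> \<le> real (s div k) * a k + C"
        using mult[OF q, of k] C[of "s mod k"] by (intro add_mono) (simp_all add: k_def less_imp_le)
      also have "real (s div k) * a k \<le> real s * (a k / real k)"
      proof -
        have "real (s div k * k) \<le> real s" by (simp only: of_nat_le_iff) simp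
        then have "real (s div k) \<le> real s / real k" by (simp add: k_def field_simps)
        then have "real (s div k) * a k \<le> real s / real k * a k" by (intro mult_right_mono nonneg)
        then show ?thesis by simp
      qed
      finally have "a s / real s \<le> (real s * (a k / real k) + C) / real s"
        by (intro divide_right_mono) auto
      also have "\<dots> = a k / real k + C / real s" by (simp add: s_def add_divide_distrib)
      also have "\<dots> < (l + e / 2) + e / 2"
      proof (intro add_strict_mono)
        show "a k / real k < l + e / 2" using m by (simp add: k_def)
        have "2 * C / e < real s" using N n by (simp add: s_def)
        then show "C / real s < e / 2" using e by (simp add: s_def field_simps)
      qed
      finally show "norm (a (Suc n) / real (Suc n) - l) < e"
        using l_le[of n] by (simp add: s_def)
    qed
  qed
  then show ?thesis by (auto simp: convergent_def)
qed

text \<open>The itinerary of \<open>x\<close> as a list: its fibres are the cells of the iterated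
  join, and concatenation and windows of lists express the action of the dynamics.\<close>

definition orbit_word :: "('a \<Rightarrow> 'a) \<Rightarrow> ('a \<Rightarrow> 'b) \<Rightarrow> nat \<Rightarrow> 'a \<Rightarrow> 'b list" where
  "orbit_word T X n x = map (\<lambda>k. X ((T ^^ k) x)) [0..<n]"

lemma length_orbit_word [simp]: "length (orbit_word T X n x) = n"
  by (simp add: orbit_word_def)

lemma orbit_word_0 [simp]: "orbit_word T X 0 x = []"
  by (simp add: orbit_word_def)

lemma orbit_word_Suc: "orbit_word T X (Suc n) x = X x # orbit_word T X n (T x)"
  by (rule nth_equalityI) (auto simp: orbit_word_def nth_Cons funpow_swap1 nth_append less_Suc_eq split: nat.split)

lemma orbit_word_Suc_right: "orbit_word T X (Suc n) x = orbit_word T X n x @ [X ((T ^^ n) x)]"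
  by (simp add: orbit_word_def)

lemma orbit_word_add:
  "orbit_word T X (m + n) x = orbit_word T X m x @ orbit_word T X n ((T ^^ m) x)"
proof (induction n)
  case (Suc n)
  have "(T ^^ (m + n)) x = (T ^^ n) ((T ^^ m) x)" by (simp add: add.commute[of m n] funpow_add)
  with Suc show ?case by (simp add: orbit_word_Suc_right)
qed simp

lemma orbit_word_shift:
  assumes "j + m \<le> N"
  shows "orbit_word T X m ((T ^^ j) x) = take m (drop j (orbit_word T X N x))"
proof -
  obtain r where N: "N = j + (m + r)" using assms by (metis add.assoc le_iff_add)
  show ?thesis by (simp add: N orbit_word_add)
qed

section \<open>Entropy of itineraries under an invariant measure\<close>

locale measure_preserving = prob_space M for M :: "'a measure" +
  fixes T :: "'a \<Rightarrow> 'a"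
  assumes T_measurable [measurable]: "T \<in> measurable M M" and distr_T: "distr M M T = M"
begin

lemma T_space: "x \<in> space M \<Longrightarrow> (T ^^ k) x \<in> space M"
  by (induction k) (auto intro: measurable_space[OF T_measurable])

lemma funpow_measurable: "(T ^^ k) \<in> measurable M M"
  by (induction k) (auto intro: measurable_comp[OF _ T_measurable])

lemma prob_vimage_T:
  assumes "A \<in> events" shows "prob ((T ^^ k) -` A \<inter> space M) = prob A"
proof (induction k)
  case 0
  show ?case using sets.sets_into_space[OF assms] by (simp add: Int_absorb2)
next
  case (Suc k)
  have "(T ^^ Suc k) -` A \<inter> space M = T -` ((T ^^ k) -` A \<inter> space M) \<inter> space M"
    using measurable_space[OF T_measurable] by (auto simp: funpow_swap1)
  then have "prob ((T ^^ Suc k) -` A \<inter> space M) = measure (distr M M T) ((T ^^ k) -` A \<inter> space M)"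
    by (simp only: measure_distr[OF T_measurable measurable_sets[OF funpow_measurable assms]])
  then show ?case by (simp only: distr_T Suc)
qed

lemma simple_function_funpow:
  assumes "simple_function M X" shows "simple_function M (\<lambda>x. X ((T ^^ k) x))"
  unfolding simple_function_def
proof (intro conjI ballI)
  show "finite ((\<lambda>x. X ((T ^^ k) x)) ` space M)"
    by (rule finite_subset[OF _ simple_functionD(1)[OF assms]]) (auto intro: T_space)
  fix v
  have "(\<lambda>x. X ((T ^^ k) x)) -` {v} \<inter> space M = (T ^^ k) -` (X -` {v} \<inter> space M) \<inter> space M"
    by (auto intro: T_space)
  then show "(\<lambda>x. X ((T ^^ k) x)) -` {v} \<inter> space M \<in> events"
    using measurable_sets[OF funpow_measurable simple_functionD(2)[OF assms]] by simp
qed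

lemma simple_function_orbit_word:
  assumes "simple_function M X" shows "simple_function M (orbit_word T X n)"
proof (induction n)
  case (Suc n)
  have "simple_function M (\<lambda>x. (\<lambda>(u, v). u @ [v]) (orbit_word T X n x, X ((T ^^ n) x)))"
    by (rule simple_function_comp_arg, intro simple_function_Pair Suc simple_function_funpow assms)
  then show ?case by (simp add: orbit_word_Suc_right[abs_def])
qed (simp add: orbit_word_def)

lemma ent_funpow:
  assumes "simple_function M X" shows "ent (\<lambda>x. X ((T ^^ k) x)) = ent X"
proof -
  have "pr (\<lambda>x. X ((T ^^ k) x)) v = pr X v" for v
  proof -
    have "(\<lambda>x. X ((T ^^ k) x)) -` {v} \<inter> space M = (T ^^ k) -` (X -` {v} \<inter> space M) \<inter> space M"
      by (auto intro: T_space)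
    then show ?thesis unfolding pr_def by (simp only: prob_vimage_T[OF simple_functionD(2)[OF assms]])
  qed
  moreover have "ent (\<lambda>x. X ((T ^^ k) x)) = (\<Sum>v\<in>X ` space M. ent_phi (pr (\<lambda>x. X ((T ^^ k) x)) v))"
    by (rule ent_superset) (use simple_functionD(1)[OF assms] in \<open>auto intro: T_space\<close>)
  ultimately show ?thesis by (simp add: ent_def)
qed

lemma ent_orbit_word_subadditive:
  assumes X: "simple_function M X"
  shows "ent (orbit_word T X (m + n)) \<le> ent (orbit_word T X m) + ent (orbit_word T X n)"
proof -
  note sm = simple_function_orbit_word[OF X, of m]
  note sn = simple_function_funpow[OF simple_function_orbit_word[OF X, of n], of m]
  have "ent (orbit_word T X (m + n)) \<le> ent (\<lambda>x. (orbit_word T X m x, orbit_word T X n ((T ^^ m) x)))"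
    by (rule ent_le_of_comp[OF simple_function_Pair[OF sm sn], where g="\<lambda>(u, v). u @ v"])
       (simp add: orbit_word_add)
  also have "\<dots> \<le> ent (orbit_word T X m) + ent (\<lambda>x. orbit_word T X n ((T ^^ m) x))"
    by (rule ent_subadditive[OF sm sn])
  finally show ?thesis by (simp only: ent_funpow[OF simple_function_orbit_word[OF X, of n], of m])
qed

lemma convergent_ent_orbit_word:
  assumes "simple_function M X"
  shows "convergent (\<lambda>n. ent (orbit_word T X (Suc n)) / real (Suc n))"
  by (rule fekete_convergent[where a="\<lambda>n. ent (orbit_word T X n)"])
     (rule ent_nonneg, rule ent_orbit_word_subadditive[OF assms])

text \<open>Each further letter of the \<open>X\<close>-itinerary costs at most
  the entropy of \<open>X\<close> given the length-\<open>m\<close> itinerary of \<open>D\<close>.\<close>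
lemma ent_orbit_word_le:
  assumes X: "simple_function M X" and D: "simple_function M D"
    and \<eta>: "ent (\<lambda>x. (X x, orbit_word T D m x)) \<le> ent (orbit_word T D m) + \<eta>"
  shows "ent (orbit_word T X n) \<le> ent (orbit_word T D (n + m)) + real n * \<eta>"
proof -
  \<comment> \<open>Length \<open>n + m\<close> makes room for a window of length \<open>m\<close>
    at each of the positions \<open>j < n\<close>.\<close>
  define W where "W = orbit_word T D (n + m)"
  have sW: "simple_function M W" unfolding W_def by (rule simple_function_orbit_word[OF D])
  note sX = simple_function_orbit_word[OF X]
  have "j \<le> n \<Longrightarrow> ent (\<lambda>x. (orbit_word T X j x, W x)) \<le> ent W + real j * \<eta>" for j
  proof (induction j)
    case 0
    show ?case using ent_comp_le[OF sW, of "\<lambda>w. ([] :: 'b list, w)"] by simp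
  next
    case (Suc j)
    let ?Y = "\<lambda>x. (orbit_word T X j x, W x)"
    let ?f = "\<lambda>(u, w). take m (drop j w)"
    have fY: "?f (?Y x) = orbit_word T D m ((T ^^ j) x)" for x
      using orbit_word_shift[of j m "n + m" T D x] Suc.prems by (simp add: W_def)
    have sY: "simple_function M ?Y" using sX sW by (rule simple_function_Pair)
    note sXj = simple_function_funpow[OF X, of j]
    have "ent (\<lambda>x. (orbit_word T X (Suc j) x, W x)) \<le> ent (\<lambda>x. (X ((T ^^ j) x), ?Y x))"
      by (rule ent_le_of_comp[OF simple_function_Pair[OF sXj sY], where g="\<lambda>(a, u, w). (u @ [a], w)"])
         (simp add: orbit_word_Suc_right)
    \<comment> \<open>Given all of \<open>?Y\<close>, the next letter is no more uncertain than
      given only the window starting at \<open>j\<close>; invariance then moves that window to time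
      0, where the hypothesis applies.\<close>
    also have "\<dots> \<le> ent (\<lambda>x. (X ((T ^^ j) x), ?f (?Y x))) - ent (\<lambda>x. ?f (?Y x)) + ent ?Y"
      using ent_submodular[OF sXj sY, of ?f] by (simp only: le_diff_eq diff_add_eq)
    also have "ent (\<lambda>x. (X ((T ^^ j) x), ?f (?Y x))) = ent (\<lambda>x. (X x, orbit_word T D m x))"
      unfolding fY
      using ent_funpow[OF simple_function_Pair[OF X simple_function_orbit_word[OF D, of m]], of j] by simp
    also have "ent (\<lambda>x. ?f (?Y x)) = ent (orbit_word T D m)"
      unfolding fY using ent_funpow[OF simple_function_orbit_word[OF D, of m], of j] by simp
    finally show ?case using Suc.IH Suc.prems \<eta> by (simp add: distrib_right)
  qed
  then have "ent (\<lambda>x. (orbit_word T X n x, W x)) \<le> ent W + real n * \<eta>" by simp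
  moreover have "ent (orbit_word T X n) \<le> ent (\<lambda>x. (orbit_word T X n x, W x))"
    by (rule ent_le_of_comp[OF simple_function_Pair[OF sX sW], where g=fst]) simp
  ultimately show ?thesis by (simp add: W_def)
qed

section \<open>Finite partitions as simple functions\<close>

definition atom :: "'a set set \<Rightarrow> 'a \<Rightarrow> 'a set" where
  "atom Q x = (THE A. A \<in> Q \<and> x \<in> A)"

lemma atom_eqI:
  assumes Q: "finite_meas_partition M Q" and A: "A \<in> Q" "x \<in> A"
  shows "atom Q x = A"
  unfolding atom_def
proof (rule the_equality)
  fix C assume C: "C \<in> Q \<and> x \<in> C"
  have "disjoint Q" using Q by (simp add: finite_meas_partition_def)
  then have "C = A \<or> C \<inter> A = {}" using C A by (auto dest: disjointD)
  then show "C = A" using C A by auto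
qed (use A in simp)

lemma atom_exists:
  assumes Q: "finite_meas_partition M Q" and x: "x \<in> space M"
  shows "atom Q x \<in> Q" "x \<in> atom Q x"
proof -
  have "x \<in> \<Union>Q" using Q x by (simp add: finite_meas_partition_def)
  then obtain B where B: "B \<in> Q" "x \<in> B" by (elim UnionE)
  show "atom Q x \<in> Q" "x \<in> atom Q x" using atom_eqI[OF Q B] B by simp_all
qed

lemma atom_eq_iff:
  assumes Q: "finite_meas_partition M Q" and x: "x \<in> space M" and A: "A \<in> Q"
  shows "atom Q x = A \<longleftrightarrow> x \<in> A"
  using atom_eqI[OF Q A, of x] atom_exists(2)[OF Q x] by metis

lemma simple_function_atom:
  assumes Q: "finite_meas_partition M Q" shows "simple_function M (atom Q)"
  unfolding simple_function_def
proof (intro conjI ballI)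
  show "finite (atom Q ` space M)"
  proof (rule finite_subset)
    show "atom Q ` space M \<subseteq> Q" using atom_exists(1)[OF Q] by (rule image_subsetI)
    show "finite Q" using Q by (simp add: finite_meas_partition_def)
  qed
  fix A assume "A \<in> atom Q ` space M"
  then have A: "A \<in> Q" using atom_exists(1)[OF Q] by (elim imageE) simp
  then have "A \<in> events" using Q by (auto simp: finite_meas_partition_def)
  moreover have "atom Q -` {A} \<inter> space M = {x \<in> space M. x \<in> A}"
    using atom_eq_iff[OF Q _ A] by auto
  moreover have "{x \<in> space M. x \<in> A} = A" using sets.sets_into_space[OF \<open>A \<in> events\<close>] by auto
  ultimately show "atom Q -` {A} \<inter> space M \<in> events" by simp
qed

text \<open>A cell of the join is fixed by one partition element per time, that is by a word of
  atoms; the condition \<open>A \<noteq> {}\<close> selects the words that occur as itineraries, and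
  these are the words over which \<open>ent\<close> sums.\<close>

lemma iter_join_eq:
  assumes Q: "finite_meas_partition M Q"
  shows "iter_join M T Q n
    = (\<lambda>v. orbit_word T (atom Q) n -` {v} \<inter> space M) ` orbit_word T (atom Q) n ` space M"
    (is "_ = ?R")
proof (intro set_eqI iffI)
  fix A assume "A \<in> iter_join M T Q n"
  then obtain c where ne: "A \<noteq> {}" and c: "\<And>k. k < n \<Longrightarrow> c k \<in> Q"
    and A: "A = space M \<inter> (\<Inter>k\<in>{..<n}. (T ^^ k) -` c k)"
    by (auto simp: iter_join_def)
  have iff: "y \<in> A \<longleftrightarrow> y \<in> space M \<and> orbit_word T (atom Q) n y = map c [0..<n]" for y
  proof (cases "y \<in> space M")
    case True
    then show ?thesis
      unfolding A orbit_word_def using atom_eq_iff[OF Q T_space[OF True] c] True by (auto simp: map_eq_conv)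
  qed (simp add: A)
  obtain x where "x \<in> A" using ne by auto
  then have "x \<in> space M" "A = orbit_word T (atom Q) n -` {orbit_word T (atom Q) n x} \<inter> space M"
    using iff by auto
  then show "A \<in> ?R" by blast
next
  fix A assume "A \<in> ?R"
  then obtain x where x: "x \<in> space M"
    and A: "A = orbit_word T (atom Q) n -` {orbit_word T (atom Q) n x} \<inter> space M" by auto
  have "A = space M \<inter> (\<Inter>k\<in>{..<n}. (T ^^ k) -` atom Q ((T ^^ k) x))"
  proof (rule set_eqI)
    fix y
    show "y \<in> A \<longleftrightarrow> y \<in> space M \<inter> (\<Inter>k\<in>{..<n}. (T ^^ k) -` atom Q ((T ^^ k) x))"
    proof (cases "y \<in> space M")
      case True
      then show ?thesis
        unfolding A orbit_word_def
        using atom_eq_iff[OF Q T_space[OF True] atom_exists(1)[OF Q T_space[OF x]]] True by (auto simp: map_eq_conv)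
    qed (simp add: A)
  qed
  moreover have "x \<in> A" using x A by auto
  ultimately show "A \<in> iter_join M T Q n"
    unfolding iter_join_def using atom_exists(1)[OF Q T_space[OF x]] by (intro CollectI conjI exI[of _ "\<lambda>k. atom Q ((T ^^ k) x)"]) auto
qed

lemma partition_entropy_iter_join:
  assumes Q: "finite_meas_partition M Q"
  shows "partition_entropy M (iter_join M T Q n) = ent (orbit_word T (atom Q) n)"
proof -
  have inj: "inj_on (\<lambda>v. orbit_word T (atom Q) n -` {v} \<inter> space M) (orbit_word T (atom Q) n ` space M)"
    by (rule inj_onI) blast
  show ?thesis
    unfolding partition_entropy_def iter_join_eq[OF Q] sum.reindex[OF inj]
    by (simp add: ent_def pr_def)
qed

lemma partition_ks_entropy_lim:
  assumes Q: "finite_meas_partition M Q"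
  shows "(\<lambda>n. ent (orbit_word T (atom Q) (Suc n)) / real (Suc n)) \<longlonglongrightarrow> partition_ks_entropy M T Q"
  unfolding partition_ks_entropy_def partition_entropy_iter_join[OF Q]
  using convergent_ent_orbit_word[OF simple_function_atom[OF Q]] by (simp add: convergent_LIMSEQ_iff)

end

section \<open>Branches and cylinders\<close>

definition inv_deriv :: "nat \<Rightarrow> real \<Rightarrow> real" where
  "inv_deriv i x = 1 / (2 * sqrt (real i + x))"

definition digit :: "real \<Rightarrow> nat" where
  "digit x = (if x < sqrt 2 - 1 then 1 else if x < sqrt 3 - 1 then 2 else 3)"

lemma space_leb01 [simp]: "space leb01 = {0..1}"
  by (simp add: leb01_def space_restrict_space)

lemma sets_leb01_iff: "A \<in> sets leb01 \<longleftrightarrow> A \<in> sets borel \<and> A \<subseteq> {0..1}"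
  unfolding leb01_def by (subst sets_restrict_space_iff) auto

lemma borel_measurable_leb01 [measurable (raw)]:
  "f \<in> measurable borel N \<Longrightarrow> f \<in> measurable leb01 N"
  unfolding leb01_def by (rule measurable_restrict_space1) simp

lemma nn_integral_leb01: "(\<integral>\<^sup>+x. f x \<partial>leb01) = (\<integral>\<^sup>+x. f x * indicator {0..1} x \<partial>lborel)"
  unfolding leb01_def by (rule nn_integral_restrict_space) simp

lemma prob_space_leb01: "prob_space leb01"
  by (rule prob_spaceI) (simp add: leb01_def space_restrict_space emeasure_restrict_space)

lemma bolyai_T_measurable_borel [measurable]: "bolyai_T \<in> borel_measurable borel"
  unfolding bolyai_T_def[abs_def] by measurable

lemma bolyai_inv_measurable [measurable]: "bolyai_inv i \<in> borel_measurable borel"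
  unfolding bolyai_inv_def[abs_def] by measurable

lemma inv_deriv_measurable [measurable]: "inv_deriv i \<in> borel_measurable borel"
  unfolding inv_deriv_def[abs_def] by measurable

lemma digit_measurable [measurable]: "digit \<in> measurable borel (count_space UNIV)"
  unfolding digit_def[abs_def] by measurable

lemma digit_in: "digit x \<in> {1, 2, 3}"
  by (simp add: digit_def)

lemma sqrt_2_3: "1 < sqrt 2" "sqrt 2 < sqrt 3" "sqrt 3 < (2::real)"
  by (simp_all add: real_less_lsqrt)

lemma sqrt_4: "sqrt 4 = (2::real)"
  using real_sqrt_abs[of 2] by simp

lemma bolyai_T_eq: "bolyai_T x = (x + 1)\<^sup>2 - real (digit x)"
  by (simp add: bolyai_T_def digit_def power2_eq_square algebra_simps)

lemma bolyai_inv_in: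
  assumes "i \<in> {1, 2, 3}" "x \<in> {0..1}" shows "bolyai_inv i x \<in> {0..1}"
proof -
  have "1 \<le> sqrt (real i + x)" using assms by auto
  moreover have "sqrt (real i + x) \<le> sqrt 4" using assms by (intro real_sqrt_le_mono) auto
  ultimately show ?thesis by (simp add: bolyai_inv_def sqrt_4)
qed

lemma digit_bounds:
  assumes "x \<in> {0..1}"
  shows "sqrt (real (digit x)) \<le> x + 1" "x + 1 \<le> sqrt (real (digit x) + 1)"
  using assms sqrt_2_3 by (auto simp: digit_def sqrt_4)

lemma bolyai_T_in:
  assumes "x \<in> {0..1}" shows "bolyai_T x \<in> {0..1}"
proof -
  have "(sqrt (real (digit x)))\<^sup>2 \<le> (x + 1)\<^sup>2" "(x + 1)\<^sup>2 \<le> (sqrt (real (digit x) + 1))\<^sup>2"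
    using assms by (auto intro!: power_mono simp del: real_sqrt_pow2_iff real_sqrt_pow2 intro: digit_bounds)
  then show ?thesis by (simp add: bolyai_T_eq)
qed

lemma bolyai_inv_bolyai_T:
  assumes "x \<in> {0..1}" shows "bolyai_inv (digit x) (bolyai_T x) = x"
  using assms by (simp add: bolyai_inv_def bolyai_T_eq)

text \<open>The endpoint \<open>y = 1\<close> has to be excluded: \<open>bolyai_inv 1 1\<close> is
  \<open>sqrt 2 - 1\<close>, which already has digit 2. Integral identities therefore use this lemma
  almost everywhere.\<close>

lemma digit_bolyai_inv:
  assumes "i \<in> {1, 2, 3}" "0 \<le> y" "y < 1" shows "digit (bolyai_inv i y) = i"
proof -
  have "sqrt (real i) \<le> sqrt (real i + y)" "sqrt (real i + y) < sqrt (real i + 1)"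
    using assms by auto
  then show ?thesis using assms(1) sqrt_2_3 by (auto simp: digit_def bolyai_inv_def)
qed

lemma bolyai_T_bolyai_inv:
  assumes "i \<in> {1, 2, 3}" "0 \<le> y" "y < 1" shows "bolyai_T (bolyai_inv i y) = y"
  using assms by (simp add: bolyai_T_eq digit_bolyai_inv) (simp add: bolyai_inv_def)

lemma inv_deriv_bounds:
  assumes "i \<in> {1, 2, 3}" "x \<in> {0..1}" shows "1 / 4 \<le> inv_deriv i x" "inv_deriv i x \<le> 1 / 2"
proof -
  have s: "1 \<le> sqrt (real i + x)" using assms by auto
  have "sqrt (real i + x) \<le> sqrt 4" using assms by (intro real_sqrt_le_mono) auto
  then have "sqrt (real i + x) \<le> 2" by (simp add: sqrt_4)
  with s show "1 / 4 \<le> inv_deriv i x" "inv_deriv i x \<le> 1 / 2"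
    by (simp_all add: inv_deriv_def field_simps)
qed

lemma bolyai_inv_has_deriv:
  assumes "i \<in> {1, 2, 3}" "x \<in> {0..1}"
  shows "(bolyai_inv i has_real_derivative inv_deriv i x) (at x)"
proof -
  have "real i + x > 0" using assms by auto
  then show ?thesis unfolding bolyai_inv_def[abs_def] inv_deriv_def
    by (auto intro!: derivative_eq_intros simp: field_simps)
qed

lemma bolyai_inv_contract:
  assumes "i \<in> {1, 2, 3}" "x \<in> {0..1}" "y \<in> {0..1}"
  shows "\<bar>bolyai_inv i x - bolyai_inv i y\<bar> \<le> \<bar>x - y\<bar> / 2"
proof -
  let ?s = "sqrt (real i + x)" let ?t = "sqrt (real i + y)"
  have st: "1 \<le> ?s" "1 \<le> ?t" using assms by auto
  have "(?s - ?t) * (?s + ?t) = x - y" using assms by (simp add: algebra_simps)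
  then have "\<bar>?s - ?t\<bar> * (?s + ?t) = \<bar>x - y\<bar>" using st by (metis abs_mult abs_of_nonneg add_nonneg_nonneg order.trans zero_le_one)
  moreover have "\<bar>?s - ?t\<bar> * 2 \<le> \<bar>?s - ?t\<bar> * (?s + ?t)" using add_mono[OF st] by (intro mult_left_mono) (simp_all only: one_add_one abs_ge_zero)
  ultimately show ?thesis by (simp add: bolyai_inv_def)
qed

text \<open>The distortion bound comes from \<open>ln (inv_deriv i x) = - ln (i + x) / 2 - ln 2\<close> and
  the Lipschitz constant \<open>1\<close> of \<open>ln\<close> on \<open>[1, \<infinity>)\<close>.\<close>
lemma inv_deriv_distortion:
  assumes "i \<in> {1, 2, 3}" "x \<in> {0..1}" "y \<in> {0..1}"
  shows "inv_deriv i x \<le> exp (\<bar>x - y\<bar> / 2) * inv_deriv i y"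
proof -
  have p: "1 \<le> real i + x" "1 \<le> real i + y" using assms by auto
  have "(real i + y) / (real i + x) \<le> 1 + \<bar>x - y\<bar>"
  proof -
    have "real i + y \<le> (real i + x) + \<bar>x - y\<bar> * 1" by simp
    also have "\<dots> \<le> (real i + x) + \<bar>x - y\<bar> * (real i + x)" using p by (intro add_left_mono mult_left_mono) auto
    finally show ?thesis using p by (simp add: field_simps)
  qed
  also have "\<dots> \<le> exp \<bar>x - y\<bar>" by (rule exp_ge_add_one_self)
  finally have "sqrt ((real i + y) / (real i + x)) \<le> sqrt (exp \<bar>x - y\<bar>)" by (rule real_sqrt_le_mono)
  also have "sqrt (exp \<bar>x - y\<bar>) = exp (\<bar>x - y\<bar> / 2)"
    by (rule real_sqrt_unique) (simp_all add: power2_eq_square exp_add[symmetric])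
  finally show ?thesis using p by (simp add: inv_deriv_def real_sqrt_divide field_simps)
qed

text \<open>Substitution on the images of [0,1] under the three inverse branches; these intervals
  cover [0,1] and overlap only in the two null points \<open>sqrt 2 - 1\<close> and
  \<open>sqrt 3 - 1\<close>.\<close>

lemma nn_integral_branches:
  assumes u [measurable]: "u \<in> borel_measurable borel"
  shows "(\<integral>\<^sup>+x. u x \<partial>leb01) = (\<Sum>i\<in>{1,2,3}. \<integral>\<^sup>+y. u (bolyai_inv i y) * ennreal (inv_deriv i y) \<partial>leb01)"
proof -
  have sub: "(\<integral>\<^sup>+x. u x * indicator {sqrt (real i) - 1..sqrt (real i + 1) - 1} x \<partial>lborel)
      = (\<integral>\<^sup>+y. u (bolyai_inv i y) * ennreal (inv_deriv i y) \<partial>leb01)" if i: "i \<in> {1, 2, 3}" for i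
  proof -
    have "(\<integral>\<^sup>+x. u x * indicator {bolyai_inv i 0..bolyai_inv i 1} x \<partial>lborel)
        = (\<integral>\<^sup>+x. u (bolyai_inv i x) * ennreal (inv_deriv i x) * indicator {0..1} x \<partial>lborel)"
    proof (rule nn_integral_substitution_aux)
      show "continuous_on {0..1} (inv_deriv i)"
        unfolding inv_deriv_def[abs_def] using i by (auto intro!: continuous_intros)
      show "0 \<le> inv_deriv i x" if "x \<in> {0..1}" for x using inv_deriv_bounds[OF i that] by simp
    qed (use bolyai_inv_has_deriv[OF i] in auto)
    then show ?thesis by (simp add: bolyai_inv_def nn_integral_leb01)
  qed
  have "AE x in lborel. x \<noteq> sqrt 2 - 1 \<and> x \<noteq> sqrt 3 - (1::real)"
    using AE_lborel_singleton[of "sqrt 2 - 1"] AE_lborel_singleton[of "sqrt 3 - 1 :: real"] by eventually_elim simp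
  then have "(\<integral>\<^sup>+x. u x \<partial>leb01) = (\<integral>\<^sup>+x. (\<Sum>i\<in>{1,2,3}. u x * indicator {sqrt (real i) - 1..sqrt (real i + 1) - 1} x) \<partial>lborel)"
    unfolding nn_integral_leb01
  proof (intro nn_integral_cong_AE, elim eventually_mono)
    have sum3: "(\<Sum>i\<in>{1,2,3}. F i) = F 1 + (F 2 + F 3)" for F :: "nat \<Rightarrow> ennreal" by simp
    fix x :: real assume x: "x \<noteq> sqrt 2 - 1 \<and> x \<noteq> sqrt 3 - 1"
    have "indicator {0..1} x = indicator {0..sqrt 2 - 1} x + indicator {sqrt 2 - 1..sqrt 3 - 1} x
        + (indicator {sqrt 3 - 1..1} x :: ennreal)"
    proof -
      have "indicator {0..1} x = indicator {0..a} x + indicator {a..b} x + (indicator {b..1} x :: ennreal)"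
        if "0 < a" "a < b" "b < 1" "x \<noteq> a" "x \<noteq> b" for a b :: real
        using that by (auto split: split_indicator)
      from this[of "sqrt 2 - 1" "sqrt 3 - 1"] show ?thesis using x sqrt_2_3 by (simp del: atLeastAtMost_iff)
    qed
    then show "u x * indicator {0..1} x = (\<Sum>i\<in>{1,2,3}. u x * indicator {sqrt (real i) - 1..sqrt (real i + 1) - 1} x)"
      unfolding sum3 by (simp add: sqrt_4 distrib_left add.assoc)
  qed
  also have "\<dots> = (\<Sum>i\<in>{1,2,3}. \<integral>\<^sup>+x. u x * indicator {sqrt (real i) - 1..sqrt (real i + 1) - 1} x \<partial>lborel)"
    by (rule nn_integral_sum) measurable
  finally show ?thesis using sub by simp
qed

lemma AE_leb01_less_1: "AE x in leb01. 0 \<le> x \<and> x < 1"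
proof -
  have "AE x in leb01. x \<noteq> 1"
    unfolding leb01_def using AE_lborel_singleton[of "1::real"] by (subst AE_restrict_space_iff) auto
  moreover have "AE x in leb01. x \<in> space leb01" by (rule AE_space)
  ultimately show ?thesis by eventually_elim auto
qed

text \<open>Duality between composition with the map and the transfer operator with weight
  \<open>inv_deriv\<close>. In nonnegative extended form it applies to indicators and densities
  alike.\<close>

lemma nn_integral_transfer:
  assumes [measurable]: "u \<in> borel_measurable borel" "v \<in> borel_measurable borel"
  shows "(\<integral>\<^sup>+x. u x * v (bolyai_T x) \<partial>leb01)
    = (\<integral>\<^sup>+y. (\<Sum>i\<in>{1,2,3}. u (bolyai_inv i y) * ennreal (inv_deriv i y)) * v y \<partial>leb01)"
proof -
  have "(\<integral>\<^sup>+x. u x * v (bolyai_T x) \<partial>leb01)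
      = (\<Sum>i\<in>{1,2,3}. \<integral>\<^sup>+y. u (bolyai_inv i y) * v (bolyai_T (bolyai_inv i y)) * ennreal (inv_deriv i y) \<partial>leb01)"
    by (rule nn_integral_branches) measurable
  also have "\<dots> = (\<Sum>i\<in>{1,2,3}. \<integral>\<^sup>+y. u (bolyai_inv i y) * ennreal (inv_deriv i y) * v y \<partial>leb01)"
  proof (rule sum.cong[OF refl], rule nn_integral_cong_AE)
    fix i :: nat assume i: "i \<in> {1, 2, 3}"
    show "AE y in leb01. u (bolyai_inv i y) * v (bolyai_T (bolyai_inv i y)) * ennreal (inv_deriv i y)
        = u (bolyai_inv i y) * ennreal (inv_deriv i y) * v y"
      using AE_leb01_less_1 by eventually_elim (simp add: bolyai_T_bolyai_inv[OF i] mult_ac)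
  qed
  also have "\<dots> = (\<integral>\<^sup>+y. (\<Sum>i\<in>{1,2,3}. u (bolyai_inv i y) * ennreal (inv_deriv i y) * v y) \<partial>leb01)"
    by (rule nn_integral_sum[symmetric]) measurable
  finally show ?thesis by (simp only: sum_distrib_right)
qed

text \<open>The first letter acts last, in accordance with \<open>orbit_word\<close>, whose first
  letter is the digit of the point itself; so \<open>inv_word w\<close> is the inverse branch of the
  iterated map on the cylinder of \<open>w\<close>.\<close>

fun inv_word :: "nat list \<Rightarrow> real \<Rightarrow> real" where
  "inv_word [] y = y"
| "inv_word (i # w) y = bolyai_inv i (inv_word w y)"

text \<open>The chain rule product for \<open>inv_word w\<close>, called \<open>J w\<close> in the
  overview.\<close>

fun word_deriv :: "nat list \<Rightarrow> real \<Rightarrow> real" where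
  "word_deriv [] y = 1"
| "word_deriv (i # w) y = inv_deriv i (inv_word w y) * word_deriv w y"

abbreviation words :: "nat \<Rightarrow> nat list set" where
  "words n \<equiv> {w. set w \<subseteq> {1, 2, 3} \<and> length w = n}"

abbreviation word :: "nat \<Rightarrow> real \<Rightarrow> nat list" where
  "word \<equiv> orbit_word bolyai_T digit"

lemma finite_words [simp]: "finite (words n)"
  by (rule finite_lists_length_eq) simp

lemma word_in: "word n x \<in> words n"
  using digit_in by (auto simp: orbit_word_def)

lemma inv_word_measurable [measurable]: "inv_word w \<in> borel_measurable borel"
proof (induction w)
  case (Cons i w)
  then have [measurable]: "inv_word w \<in> borel_measurable borel" .
  have "(\<lambda>y. bolyai_inv i (inv_word w y)) \<in> borel_measurable borel" by measurable
  then show ?case by simp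
qed simp

lemma word_deriv_measurable [measurable]: "word_deriv w \<in> borel_measurable borel"
proof (induction w)
  case (Cons i w)
  then have [measurable]: "word_deriv w \<in> borel_measurable borel" .
  have "(\<lambda>y. inv_deriv i (inv_word w y) * word_deriv w y) \<in> borel_measurable borel" by measurable
  then show ?case by simp
qed simp

lemma funpow_bolyai_T_measurable [measurable]: "(bolyai_T ^^ n) \<in> borel_measurable borel"
  by (induction n) (auto intro: measurable_comp[OF _ bolyai_T_measurable_borel])

lemma word_measurable [measurable]: "word n \<in> measurable borel (count_space UNIV)"
proof (induction n)
  case (Suc n)
  note [measurable] = Suc
  have "(\<lambda>x. digit x # word n (bolyai_T x)) \<in> measurable borel (count_space UNIV)"
    by measurable
  then show ?case by (simp add: orbit_word_Suc[abs_def])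
qed (simp add: orbit_word_def[abs_def])

lemma inv_word_in: "set w \<subseteq> {1, 2, 3} \<Longrightarrow> y \<in> {0..1} \<Longrightarrow> inv_word w y \<in> {0..1}"
  by (induction w) (auto simp del: atLeastAtMost_iff intro!: bolyai_inv_in)

lemma word_deriv_pos: "set w \<subseteq> {1, 2, 3} \<Longrightarrow> y \<in> {0..1} \<Longrightarrow> 0 < word_deriv w y"
proof (induction w)
  case (Cons i w)
  then have "i \<in> {1, 2, 3}" "inv_word w y \<in> {0..1}" using inv_word_in[of w y] by auto
  then have "0 < inv_deriv i (inv_word w y)" using inv_deriv_bounds(1)[of i "inv_word w y"] by linarith
  then show ?case using Cons by simp
qed simp

lemma inv_word_contract:
  assumes "set w \<subseteq> {1, 2, 3}" "x \<in> {0..1}" "y \<in> {0..1}"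
  shows "\<bar>inv_word w x - inv_word w y\<bar> \<le> \<bar>x - y\<bar> / 2 ^ length w"
  using assms(1)
proof (induction w)
  case (Cons i w)
  then have i: "i \<in> {1, 2, 3}" and w: "set w \<subseteq> {1, 2, 3}" by auto
  have "\<bar>inv_word (i # w) x - inv_word (i # w) y\<bar> \<le> \<bar>inv_word w x - inv_word w y\<bar> / 2"
    using bolyai_inv_contract[OF i inv_word_in[OF w assms(2)] inv_word_in[OF w assms(3)]] by simp
  also have "\<dots> \<le> (\<bar>x - y\<bar> / 2 ^ length w) / 2" using Cons.IH[OF w] by (intro divide_right_mono) auto
  finally show ?case by simp
qed simp

text \<open>The exponent is the geometric sum of \<open>1 / 2 ^ k\<close> for \<open>k\<close> from
  1 to \<open>length w\<close>: a letter put in front contributes half the distance of its two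
  arguments, which the shorter word has already contracted. Keeping the partial sum lets the
  induction close and bounds the distortion uniformly in the length.\<close>

lemma word_deriv_distortion:
  assumes "set w \<subseteq> {1, 2, 3}" "x \<in> {0..1}" "y \<in> {0..1}"
  shows "word_deriv w x \<le> exp ((1 - 1 / 2 ^ length w) * \<bar>x - y\<bar>) * word_deriv w y"
  using assms(1)
proof (induction w)
  case (Cons i w)
  then have i: "i \<in> {1, 2, 3}" and w: "set w \<subseteq> {1, 2, 3}" by auto
  note in1 = inv_word_in[OF w assms(2)] and in2 = inv_word_in[OF w assms(3)]
  have "inv_deriv i (inv_word w x) \<le> exp (\<bar>inv_word w x - inv_word w y\<bar> / 2) * inv_deriv i (inv_word w y)"
    by (rule inv_deriv_distortion[OF i in1 in2])
  also have "\<dots> \<le> exp ((\<bar>x - y\<bar> / 2 ^ length w) / 2) * inv_deriv i (inv_word w y)"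
    using inv_word_contract[OF w assms(2,3)] inv_deriv_bounds(1)[OF i in2]
    by (intro mult_right_mono) (auto simp: divide_right_mono)
  finally have "inv_deriv i (inv_word w x) * word_deriv w x
      \<le> (exp ((\<bar>x - y\<bar> / 2 ^ length w) / 2) * inv_deriv i (inv_word w y))
        * (exp ((1 - 1 / 2 ^ length w) * \<bar>x - y\<bar>) * word_deriv w y)"
    using Cons.IH[OF w] word_deriv_pos[OF w assms(2)] inv_deriv_bounds(1)[OF i in2]
    by (intro mult_mono) auto
  also have "\<dots> = exp ((\<bar>x - y\<bar> / 2 ^ length w) / 2 + (1 - 1 / 2 ^ length w) * \<bar>x - y\<bar>)
      * (inv_deriv i (inv_word w y) * word_deriv w y)"
    by (simp add: exp_add mult_ac)
  also have "(\<bar>x - y\<bar> / 2 ^ length w) / 2 + (1 - 1 / 2 ^ length w) * \<bar>x - y\<bar> = (1 - 1 / 2 ^ length (i # w)) * \<bar>x - y\<bar>"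
    by (simp add: field_simps)
  finally show ?case by simp
qed simp

lemma nn_integral_cylinder:
  assumes [measurable]: "u \<in> borel_measurable borel" "v \<in> borel_measurable borel"
    and w: "w \<in> words n"
  shows "(\<integral>\<^sup>+x. u x * indicator {x. word n x = w} x * v ((bolyai_T ^^ n) x) \<partial>leb01)
    = (\<integral>\<^sup>+y. u (inv_word w y) * ennreal (word_deriv w y) * v y \<partial>leb01)"
  using assms(1) w
proof (induction w arbitrary: u n)
  case (Cons i w)
  note [measurable] = Cons.prems(1)
  obtain m where n: "n = Suc m" and w: "w \<in> words m" and i: "i \<in> {1, 2, 3}" using Cons.prems by (cases n) auto
  let ?U = "\<lambda>x. u x * indicator {x. digit x = i} x"
  let ?V = "\<lambda>z. indicator {z. word m z = w} z * v ((bolyai_T ^^ m) z) :: ennreal"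
  have "(\<integral>\<^sup>+x. u x * indicator {x. word n x = i # w} x * v ((bolyai_T ^^ n) x) \<partial>leb01)
      = (\<integral>\<^sup>+x. ?U x * ?V (bolyai_T x) \<partial>leb01)"
    by (rule nn_integral_cong) (auto simp: n orbit_word_Suc funpow_swap1 split: split_indicator)
  also have "\<dots> = (\<integral>\<^sup>+y. (\<Sum>j\<in>{1,2,3}. ?U (bolyai_inv j y) * ennreal (inv_deriv j y)) * ?V y \<partial>leb01)"
    by (rule nn_integral_transfer) measurable
  \<comment> \<open>Only the preimage in branch \<open>i\<close> has digit \<open>i\<close>, so a
    single term of the transfer sum survives for almost every \<open>y\<close>.\<close>
  also have "\<dots> = (\<integral>\<^sup>+y. (u (bolyai_inv i y) * ennreal (inv_deriv i y)) * ?V y \<partial>leb01)"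
  proof (rule nn_integral_cong_AE)
    show "AE y in leb01. (\<Sum>j\<in>{1,2,3}. ?U (bolyai_inv j y) * ennreal (inv_deriv j y)) * ?V y
       = (u (bolyai_inv i y) * ennreal (inv_deriv i y)) * ?V y"
      using AE_leb01_less_1
    proof eventually_elim
      case (elim y)
      then have "digit (bolyai_inv 1 y) = 1" "digit (bolyai_inv (Suc 0) y) = 1"
         "digit (bolyai_inv 2 y) = 2" "digit (bolyai_inv 3 y) = 3"
        using digit_bolyai_inv[of _ y] by auto
      then show ?case using i by auto
    qed
  qed
  also have "\<dots> = (\<integral>\<^sup>+y. (u (bolyai_inv i y) * ennreal (inv_deriv i y)) * indicator {z. word m z = w} y * v ((bolyai_T ^^ m) y) \<partial>leb01)"
    by (simp add: mult_ac)
  also have "\<dots> = (\<integral>\<^sup>+y. (u (bolyai_inv i (inv_word w y)) * ennreal (inv_deriv i (inv_word w y))) * ennreal (word_deriv w y) * v y \<partial>leb01)"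
    by (rule Cons.IH[OF _ w]) measurable
  also have "\<dots> = (\<integral>\<^sup>+y. u (inv_word (i # w) y) * ennreal (word_deriv (i # w) y) * v y \<partial>leb01)"
  proof (rule nn_integral_cong)
    fix y assume "y \<in> space leb01"
    then have "0 \<le> word_deriv w y" "0 \<le> inv_deriv i (inv_word w y)"
      using w word_deriv_pos[of w y] inv_deriv_bounds(1)[OF i inv_word_in[of w y]] by auto
    then show "(u (bolyai_inv i (inv_word w y)) * ennreal (inv_deriv i (inv_word w y))) * ennreal (word_deriv w y) * v y
        = u (inv_word (i # w) y) * ennreal (word_deriv (i # w) y) * v y"
      by (simp add: ennreal_mult mult_ac)
  qed
  finally show ?case .
qed auto

section \<open>The invariant density\<close>

interpretation leb01: prob_space leb01
  by (rule prob_space_leb01)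

lemma measure_leb01_unit [simp]: "measure leb01 {0..1} = 1"
  using leb01.prob_space by simp

text \<open>On [0,1] this is \<open>transfer_op 0\<close>, with the derivative in closed
  form.\<close>

definition transfer :: "(real \<Rightarrow> real) \<Rightarrow> real \<Rightarrow> real" where
  "transfer f x = (\<Sum>i\<in>{1,2,3}. inv_deriv i x * f (bolyai_inv i x))"

text \<open>Functions whose logarithm is \<open>K\<close>-Lipschitz on [0,1], written without
  logarithms so that the zero function is included and sums and limits are easily handled.\<close>

definition cone :: "real \<Rightarrow> (real \<Rightarrow> real) \<Rightarrow> bool" where
  "cone K f \<longleftrightarrow> f \<in> borel_measurable borel \<and> (\<forall>x\<in>{0..1}. 0 \<le> f x) \<and>
     (\<forall>x\<in>{0..1}. \<forall>y\<in>{0..1}. f x \<le> exp (K * \<bar>x - y\<bar>) * f y)"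

abbreviation mass :: "(real \<Rightarrow> real) \<Rightarrow> real" where
  "mass f \<equiv> \<integral>x. f x \<partial>leb01"

lemma coneI:
  assumes "f \<in> borel_measurable borel" "\<And>x. x \<in> {0..1} \<Longrightarrow> 0 \<le> f x"
    "\<And>x y. x \<in> {0..1} \<Longrightarrow> y \<in> {0..1} \<Longrightarrow> f x \<le> exp (K * \<bar>x - y\<bar>) * f y"
  shows "cone K f"
  using assms by (simp add: cone_def)

lemma cone_measurable: "cone K f \<Longrightarrow> f \<in> borel_measurable borel"
  and cone_nonneg: "cone K f \<Longrightarrow> x \<in> {0..1} \<Longrightarrow> 0 \<le> f x"
  and cone_distortion: "cone K f \<Longrightarrow> x \<in> {0..1} \<Longrightarrow> y \<in> {0..1} \<Longrightarrow> f x \<le> exp (K * \<bar>x - y\<bar>) * f y"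
  by (simp_all add: cone_def)

lemma cone_mono:
  assumes "cone K f" "K \<le> K'" shows "cone K' f"
proof (rule coneI)
  fix x y :: real assume xy: "x \<in> {0..1}" "y \<in> {0..1}"
  have "f x \<le> exp (K * \<bar>x - y\<bar>) * f y" by (rule cone_distortion[OF assms(1) xy])
  also have "\<dots> \<le> exp (K' * \<bar>x - y\<bar>) * f y"
    using assms cone_nonneg[OF assms(1) xy(2)] by (intro mult_right_mono) (auto intro!: mult_right_mono)
  finally show "f x \<le> exp (K' * \<bar>x - y\<bar>) * f y" .
qed (use assms cone_measurable cone_nonneg in auto)

lemma cone_le:
  assumes "cone K f" "0 \<le> K" "x \<in> {0..1}" "y \<in> {0..1}"
  shows "f x \<le> exp K * f y"
proof -
  have "K * \<bar>x - y\<bar> \<le> K * 1" using assms by (intro mult_left_mono) auto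
  then have "exp (K * \<bar>x - y\<bar>) * f y \<le> exp K * f y"
    using cone_nonneg[OF assms(1,4)] by (intro mult_right_mono) auto
  then show ?thesis using cone_distortion[OF assms(1,3,4)] by linarith
qed

lemma integrable_bounded_leb01:
  assumes "f \<in> borel_measurable borel" "\<And>x. x \<in> {0..1} \<Longrightarrow> \<bar>f x :: real\<bar> \<le> B"
  shows "integrable leb01 f"
  by (rule leb01.integrable_const_bound[of _ B]) (use assms in \<open>auto intro!: AE_I2\<close>)

lemma cone_integrable:
  assumes "cone K f" "0 \<le> K" shows "integrable leb01 f"
  by (rule integrable_bounded_leb01[of _ "exp K * f 0"])
     (use assms cone_measurable cone_le[OF assms, of _ 0] cone_nonneg in auto)

lemma cone_mass_bounds:
  assumes "cone K f" "0 \<le> K" "x \<in> {0..1}"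
  shows "f x \<le> exp K * mass f" "mass f \<le> exp K * f x"
proof -
  note int = cone_integrable[OF assms(1,2)]
  have "mass (\<lambda>_. f x) \<le> mass (\<lambda>y. exp K * f y)"
    using cone_le[OF assms] by (intro integral_mono integrable_mult_right int) auto
  then show "f x \<le> exp K * mass f" by simp
  have "mass f \<le> mass (\<lambda>_. exp K * f x)"
    using cone_le[OF assms(1,2) _ assms(3)] by (intro integral_mono int) auto
  then show "mass f \<le> exp K * f x" by simp
qed

lemma cone_scale:
  assumes "cone K f" "0 \<le> a" shows "cone K (\<lambda>x. a * f x)"
proof (rule coneI)
  fix x y :: real assume xy: "x \<in> {0..1}" "y \<in> {0..1}"
  show "a * f x \<le> exp (K * \<bar>x - y\<bar>) * (a * f y)"
    using mult_left_mono[OF cone_distortion[OF assms(1) xy] assms(2)] by (simp add: mult_ac)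
qed (use assms cone_measurable[OF assms(1)] cone_nonneg in auto)

lemma transfer_measurable:
  assumes [measurable]: "f \<in> borel_measurable borel" shows "transfer f \<in> borel_measurable borel"
  unfolding transfer_def[abs_def] by measurable

lemma inv_deriv_nonneg: "i \<in> {1, 2, 3} \<Longrightarrow> x \<in> {0..1} \<Longrightarrow> 0 \<le> inv_deriv i x"
  using inv_deriv_bounds(1)[of i x] by linarith

text \<open>A branch halves distances, which turns \<open>K\<close> into \<open>K / 2\<close>, and
  its weight adds distortion \<open>1 / 2\<close>. The map \<open>K \<mapsto> (K + 1) / 2\<close>
  has fixed point 1, so every \<open>K > 1\<close> is strictly improved; \<open>K = 2\<close> gives
  \<open>3/2\<close>.\<close>

lemma cone_transfer:
  assumes f: "cone K f" and K: "0 \<le> K" shows "cone ((K + 1) / 2) (transfer f)"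
proof (rule coneI)
  show "transfer f \<in> borel_measurable borel" by (rule transfer_measurable[OF cone_measurable[OF f]])
  show "0 \<le> transfer f x" if "x \<in> {0..1}" for x
    unfolding transfer_def using that
    by (intro sum_nonneg mult_nonneg_nonneg inv_deriv_nonneg cone_nonneg[OF f] bolyai_inv_in)
  fix x y :: real assume xy: "x \<in> {0..1}" "y \<in> {0..1}"
  have "inv_deriv i x * f (bolyai_inv i x) \<le> exp ((K + 1) / 2 * \<bar>x - y\<bar>) * (inv_deriv i y * f (bolyai_inv i y))"
    if i: "i \<in> {1, 2, 3}" for i
  proof -
    note b = bolyai_inv_in[OF i xy(1)] bolyai_inv_in[OF i xy(2)]
    have "f (bolyai_inv i x) \<le> exp (K * \<bar>bolyai_inv i x - bolyai_inv i y\<bar>) * f (bolyai_inv i y)"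
      by (rule cone_distortion[OF f b])
    also have "\<dots> \<le> exp (K * (\<bar>x - y\<bar> / 2)) * f (bolyai_inv i y)"
      using cone_nonneg[OF f b(2)] mult_left_mono[OF bolyai_inv_contract[OF i xy] K]
      by (intro mult_right_mono) auto
    finally have "inv_deriv i x * f (bolyai_inv i x)
        \<le> (exp (\<bar>x - y\<bar> / 2) * inv_deriv i y) * (exp (K * (\<bar>x - y\<bar> / 2)) * f (bolyai_inv i y))"
      using inv_deriv_nonneg[OF i xy(2)] cone_nonneg[OF f b(1)]
      by (intro mult_mono inv_deriv_distortion[OF i xy]) auto
    also have "\<dots> = exp (\<bar>x - y\<bar> / 2 + K * (\<bar>x - y\<bar> / 2)) * (inv_deriv i y * f (bolyai_inv i y))"
      by (simp add: exp_add mult_ac)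
    also have "\<bar>x - y\<bar> / 2 + K * (\<bar>x - y\<bar> / 2) = (K + 1) / 2 * \<bar>x - y\<bar>"
      by (simp add: field_simps)
    finally show ?thesis .
  qed
  then show "transfer f x \<le> exp ((K + 1) / 2 * \<bar>x - y\<bar>) * transfer f y"
    unfolding transfer_def sum_distrib_left by (intro sum_mono)
qed

lemma nn_integral_transfer_cone:
  assumes f: "cone K f" and v [measurable]: "v \<in> borel_measurable borel"
  shows "(\<integral>\<^sup>+x. ennreal (f x) * v (bolyai_T x) \<partial>leb01) = (\<integral>\<^sup>+x. ennreal (transfer f x) * v x \<partial>leb01)"
proof -
  note [measurable] = cone_measurable[OF f]
  have "(\<integral>\<^sup>+x. ennreal (f x) * v (bolyai_T x) \<partial>leb01)
    = (\<integral>\<^sup>+y. (\<Sum>i\<in>{1,2,3}. ennreal (f (bolyai_inv i y)) * ennreal (inv_deriv i y)) * v y \<partial>leb01)"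
    by (rule nn_integral_transfer) measurable
  also have "\<dots> = (\<integral>\<^sup>+y. ennreal (transfer f y) * v y \<partial>leb01)"
  proof (rule nn_integral_cong)
    fix y assume "y \<in> space leb01"
    then have y: "y \<in> {0..1}" by simp
    have "(\<Sum>i\<in>{1,2,3}. ennreal (f (bolyai_inv i y)) * ennreal (inv_deriv i y))
        = (\<Sum>i\<in>{1,2,3}. ennreal (inv_deriv i y * f (bolyai_inv i y)))"
      by (rule sum.cong[OF refl])
         (use cone_nonneg[OF f bolyai_inv_in[OF _ y]] inv_deriv_nonneg[OF _ y] in \<open>simp add: ennreal_mult mult.commute\<close>)
    also have "\<dots> = ennreal (transfer f y)"
      unfolding transfer_def using y
      by (intro sum_ennreal mult_nonneg_nonneg inv_deriv_nonneg cone_nonneg[OF f] bolyai_inv_in)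
    finally show "(\<Sum>i\<in>{1,2,3}. ennreal (f (bolyai_inv i y)) * ennreal (inv_deriv i y)) * v y = ennreal (transfer f y) * v y"
      by simp
  qed
  finally show ?thesis .
qed

lemma cone_mass_nn_integral:
  assumes "cone K f" shows "mass f = enn2real (\<integral>\<^sup>+x. ennreal (f x) \<partial>leb01)"
  by (rule integral_eq_nn_integral)
     (use cone_measurable[OF assms] cone_nonneg[OF assms] in \<open>auto intro!: AE_I2\<close>)

lemma mass_transfer:
  assumes f: "cone K f" and K: "0 \<le> K" shows "mass (transfer f) = mass f"
  using nn_integral_transfer_cone[OF f, of "\<lambda>_. 1"]
  by (simp add: cone_mass_nn_integral[OF f] cone_mass_nn_integral[OF cone_transfer[OF f K]])

lemma cone_funpow_transfer:
  assumes "cone 2 f" shows "cone 2 ((transfer ^^ n) f)"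
  by (induction n) (use assms in \<open>auto intro!: cone_mono[OF cone_transfer[of 2]]\<close>)

lemma mass_funpow_transfer:
  assumes "cone 2 f" shows "mass ((transfer ^^ n) f) = mass f"
  by (induction n) (simp_all add: mass_transfer[OF cone_funpow_transfer[OF assms]])

lemma nn_integral_funpow_transfer:
  assumes f: "cone 2 f" and [measurable]: "v \<in> borel_measurable borel"
  shows "(\<integral>\<^sup>+x. ennreal (f x) * v ((bolyai_T ^^ n) x) \<partial>leb01)
    = (\<integral>\<^sup>+x. ennreal ((transfer ^^ n) f x) * v x \<partial>leb01)"
  using assms(2)
proof (induction n arbitrary: v)
  case (Suc n)
  note [measurable] = Suc.prems
  have "(\<integral>\<^sup>+x. ennreal (f x) * v ((bolyai_T ^^ Suc n) x) \<partial>leb01)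
      = (\<integral>\<^sup>+x. ennreal ((transfer ^^ n) f x) * v (bolyai_T x) \<partial>leb01)"
    using Suc.IH[of "\<lambda>x. v (bolyai_T x)"] by simp
  also have "\<dots> = (\<integral>\<^sup>+x. ennreal ((transfer ^^ Suc n) f x) * v x \<partial>leb01)"
    using nn_integral_transfer_cone[OF cone_funpow_transfer[OF f] Suc.prems] by simp
  finally show ?case .
qed simp

lemma transfer_affine: "transfer (\<lambda>x. a * f x + b * g x) = (\<lambda>x. a * transfer f x + b * transfer g x)"
  by (simp add: transfer_def fun_eq_iff algebra_simps)

lemma funpow_transfer_affine:
  "(transfer ^^ n) (\<lambda>x. a * f x + b * g x) = (\<lambda>x. a * (transfer ^^ n) f x + b * (transfer ^^ n) g x)"
  by (induction n) (simp_all add: transfer_affine)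

text \<open>A function in \<open>cone (3/2)\<close> of mass one is at least
  \<open>exp (- (3/2))\<close> on [0,1]; the further factor \<open>1 / 4\<close> keeps the
  difference with the constant inside \<open>cone 2\<close>.\<close>

definition contraction_gap :: real where
  "contraction_gap = exp (- (3/2)) / 4"

lemma contraction_gap_bounds: "0 < contraction_gap" "contraction_gap < 1"
proof -
  have "exp (- (3/2) :: real) \<le> 1" by simp
  then have "exp (- (3/2) :: real) < 4" by linarith
  then show "0 < contraction_gap" "contraction_gap < 1" by (simp_all add: contraction_gap_def)
qed

text \<open>The improvement of the cone parameter from \<open>2\<close> to \<open>3/2\<close> leaves room to subtract a fixed
  multiple of the constant function \<open>1\<close>; this is what drives the exponential contraction.\<close>
lemma transfer_split:
  assumes f: "cone 2 f" and m: "mass f = 1"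
  obtains g where "cone 2 g" "mass g = 1"
    "transfer f = (\<lambda>x. contraction_gap * 1 + (1 - contraction_gap) * g x)"
proof
  let ?c = contraction_gap
  define h where "h = transfer f"
  have h: "cone (3/2) h" using cone_transfer[OF f] by (simp add: h_def)
  have mh: "mass h = 1" using mass_transfer[OF f] m by (simp add: h_def)
  have h_ge: "4 * ?c \<le> h x" if "x \<in> {0..1}" for x
    using cone_mass_bounds(2)[OF h _ that] mh by (simp add: contraction_gap_def exp_minus field_simps)
  have "cone 2 (\<lambda>x. h x - ?c)"
  proof (rule coneI)
    fix x y :: real assume xy: "x \<in> {0..1}" "y \<in> {0..1}"
    \<comment> \<open>In terms of \<open>s\<close> the cone inequality for \<open>h - ?c\<close>
      follows from \<open>?c * (s ^ 4 - 1) \<le> h y * (s ^ 4 - s ^ 3)\<close>. Since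
      \<open>4 * ?c \<le> h y\<close>, removing the common factor \<open>s - 1\<close> reduces this
      to \<open>(s + 1) * (s\<^sup>2 + 1) \<le> 4 * s ^ 3\<close>, true for
      \<open>s \<ge> 1\<close>.\<close>
    define s where "s = exp (\<bar>x - y\<bar> / 2)"
    have s: "1 \<le> s" by (simp add: s_def)
    have e: "exp (3/2 * \<bar>x - y\<bar>) = s ^ 3" "exp (2 * \<bar>x - y\<bar>) = s ^ 4"
      by (simp_all add: s_def exp_of_nat_mult[symmetric])
    have "(s + 1) * (s\<^sup>2 + 1) \<le> 4 * s ^ 3"
    proof -
      have "1 \<le> s\<^sup>2" using s by (simp add: power_le_one_iff one_le_power)
      then have "(s + 1) * (s\<^sup>2 + 1) \<le> (2 * s) * (2 * s\<^sup>2)" using s by (intro mult_mono) auto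
      then show ?thesis by (simp add: power2_eq_square power3_eq_cube)
    qed
    then have "?c * ((s - 1) * ((s + 1) * (s\<^sup>2 + 1))) \<le> ?c * ((s - 1) * (4 * s ^ 3))"
      using contraction_gap_bounds(1) s by (intro mult_left_mono) auto
    also have "\<dots> = (4 * ?c) * (s ^ 4 - s ^ 3)" by (simp add: algebra_simps power_numeral_reduce)
    also have "\<dots> \<le> h y * (s ^ 4 - s ^ 3)"
      using h_ge[OF xy(2)] s by (intro mult_right_mono) (auto intro: power_increasing)
    finally have "?c * (s ^ 4 - 1) \<le> h y * (s ^ 4 - s ^ 3)"
      by (simp add: algebra_simps power_numeral_reduce)
    moreover have "h x \<le> s ^ 3 * h y" using cone_distortion[OF h xy] by (simp only: e)
    ultimately show "h x - ?c \<le> exp (2 * \<bar>x - y\<bar>) * (h y - ?c)"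
      by (simp add: e algebra_simps)
  next
    fix x :: real assume "x \<in> {0..1}"
    then show "0 \<le> h x - ?c" using h_ge[of x] contraction_gap_bounds(1) by linarith
  qed (use cone_measurable[OF h] in measurable)
  moreover define g where "g = (\<lambda>x. 1 / (1 - ?c) * (h x - ?c))"
  ultimately show "cone 2 g" unfolding g_def using contraction_gap_bounds(2) by (intro cone_scale) simp_all
  have "mass (\<lambda>x. h x - ?c) = 1 - ?c"
    using cone_integrable[OF h] mh by (subst Bochner_Integration.integral_diff) auto
  then show "mass g = 1" using contraction_gap_bounds(2) by (simp add: g_def)
  show "transfer f = (\<lambda>x. ?c * 1 + (1 - ?c) * g x)"
    using contraction_gap_bounds(2) by (simp add: g_def h_def fun_eq_iff)
qed

text \<open>When both functions are split once, the common constant part cancels in the difference,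
  and the remainders form a pair of the same kind scaled by \<open>1 - contraction_gap\<close>. The
  factor \<open>exp 2\<close> bounds the initial difference.\<close>

lemma funpow_transfer_contract:
  assumes "cone 2 f" "mass f = 1" "cone 2 g" "mass g = 1" "x \<in> {0..1}"
  shows "\<bar>(transfer ^^ n) f x - (transfer ^^ n) g x\<bar> \<le> (1 - contraction_gap) ^ n * exp 2"
  using assms
proof (induction n arbitrary: f g)
  case 0
  then have "0 \<le> f x" "f x \<le> exp 2" "0 \<le> g x" "g x \<le> exp 2"
    using cone_mass_bounds(1)[of 2 _ x] cone_nonneg[of 2 _ x] by force+
  then show ?case by simp
next
  case (Suc n)
  let ?c = contraction_gap
  obtain f' where f': "cone 2 f'" "mass f' = 1" "transfer f = (\<lambda>x. ?c * 1 + (1 - ?c) * f' x)"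
    by (rule transfer_split[OF Suc.prems(1,2)])
  obtain g' where g': "cone 2 g'" "mass g' = 1" "transfer g = (\<lambda>x. ?c * 1 + (1 - ?c) * g' x)"
    by (rule transfer_split[OF Suc.prems(3,4)])
  have "(transfer ^^ Suc n) f x - (transfer ^^ Suc n) g x
      = (transfer ^^ n) (transfer f) x - (transfer ^^ n) (transfer g) x"
    by (simp add: funpow_swap1)
  also have "\<dots> = (1 - ?c) * ((transfer ^^ n) f' x - (transfer ^^ n) g' x)"
    unfolding f'(3) g'(3) funpow_transfer_affine by (simp add: algebra_simps)
  finally show ?case
    using mult_left_mono[OF Suc.IH[OF f'(1,2) g'(1,2) Suc.prems(5)], of "1 - ?c"] contraction_gap_bounds(2)
    by (simp add: abs_mult mult_ac)
qed

lemma cone_one: "cone 2 (\<lambda>_. 1)" and mass_one: "mass (\<lambda>_. 1) = 1"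
  by (auto intro!: coneI)

definition inv_density :: "real \<Rightarrow> real" where
  "inv_density x = lim (\<lambda>n. (transfer ^^ n) (\<lambda>_. 1) x)"

lemma contraction_tendsto: "(\<lambda>n. (1 - contraction_gap) ^ n * exp 2) \<longlonglongrightarrow> 0"
  using contraction_gap_bounds by (intro tendsto_mult_left_zero LIMSEQ_power_zero) auto

lemma funpow_transfer_one_tendsto:
  assumes x: "x \<in> {0..1}" shows "(\<lambda>n. (transfer ^^ n) (\<lambda>_. 1) x) \<longlonglongrightarrow> inv_density x"
proof -
  have "Cauchy (\<lambda>n. (transfer ^^ n) (\<lambda>_. 1) x)"
  proof (rule metric_CauchyI)
    fix e :: real assume "0 < e"
    then obtain N where N: "(1 - contraction_gap) ^ N * exp 2 < e / 2"
      using order_tendstoD(2)[OF contraction_tendsto, of "e / 2"] by (auto simp: eventually_sequentially)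
    \<comment> \<open>Iterate \<open>N + k\<close> of 1 is iterate \<open>N\<close> of another
      mass-one element of \<open>cone 2\<close>, so contraction compares it with iterate
      \<open>N\<close> of 1 itself.\<close>
    have near: "dist ((transfer ^^ N) (\<lambda>_. 1) x) ((transfer ^^ m) (\<lambda>_. 1) x) < e / 2" if ge: "m \<ge> N" for m
    proof -
      obtain k where m: "m = N + k" using le_Suc_ex[OF ge] by (elim exE)
      have "\<bar>(transfer ^^ N) (\<lambda>_. 1) x - (transfer ^^ N) ((transfer ^^ k) (\<lambda>_. 1)) x\<bar> \<le> (1 - contraction_gap) ^ N * exp 2"
        using x mass_funpow_transfer[OF cone_one]
        by (intro funpow_transfer_contract cone_funpow_transfer cone_one mass_one) (simp_all add: mass_one)
      with N show ?thesis by (simp add: m funpow_add dist_real_def)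
    qed
    show "\<exists>M. \<forall>m\<ge>M. \<forall>n\<ge>M. dist ((transfer ^^ m) (\<lambda>_. 1) x) ((transfer ^^ n) (\<lambda>_. 1) x) < e"
      using near by (metis dist_triangle_half_r)
  qed
  then show ?thesis unfolding inv_density_def by (simp add: Cauchy_convergent_iff convergent_LIMSEQ_iff)
qed

lemma funpow_transfer_tendsto:
  assumes "cone 2 f" "mass f = 1" "x \<in> {0..1}"
  shows "(\<lambda>n. (transfer ^^ n) f x) \<longlonglongrightarrow> inv_density x"
proof -
  have "(\<lambda>n. (transfer ^^ n) f x - (transfer ^^ n) (\<lambda>_. 1) x) \<longlonglongrightarrow> 0"
    by (rule Lim_null_comparison[OF _ contraction_tendsto])
       (use funpow_transfer_contract[OF assms(1,2) cone_one mass_one assms(3)] in auto)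
  from tendsto_add[OF this funpow_transfer_one_tendsto[OF assms(3)]] show ?thesis by simp
qed

lemma cone_inv_density: "cone 2 inv_density"
proof (rule coneI)
  have [measurable]: "(transfer ^^ n) (\<lambda>_. 1) \<in> borel_measurable borel" for n
    by (rule cone_measurable[OF cone_funpow_transfer[OF cone_one]])
  show "inv_density \<in> borel_measurable borel"
    unfolding inv_density_def[abs_def] by (rule borel_measurable_lim_metric) measurable
  show "0 \<le> inv_density x" if "x \<in> {0..1}" for x
    by (rule LIMSEQ_le_const[OF funpow_transfer_one_tendsto[OF that]])
       (use cone_nonneg[OF cone_funpow_transfer[OF cone_one] that] in auto)
  fix x y :: real assume xy: "x \<in> {0..1}" "y \<in> {0..1}"
  show "inv_density x \<le> exp (2 * \<bar>x - y\<bar>) * inv_density y"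
    by (rule LIMSEQ_le[OF funpow_transfer_one_tendsto[OF xy(1)] tendsto_mult_left[OF funpow_transfer_one_tendsto[OF xy(2)]]])
       (use cone_distortion[OF cone_funpow_transfer[OF cone_one] xy] in auto)
qed

lemma integral_funpow_transfer_tendsto:
  assumes f: "cone 2 f" "mass f = 1" and A: "A \<in> sets borel"
  shows "(\<lambda>n. \<integral>x. (transfer ^^ n) f x * indicator A x \<partial>leb01) \<longlonglongrightarrow> (\<integral>x. inv_density x * indicator A x \<partial>leb01)"
proof (rule integral_dominated_convergence[where w="\<lambda>_. exp 2"])
  note [measurable] = A cone_measurable[OF cone_inv_density] cone_measurable[OF cone_funpow_transfer[OF f(1)]]
  show "(\<lambda>x. inv_density x * indicator A x) \<in> borel_measurable leb01" by measurable
  show "(\<lambda>x. (transfer ^^ n) f x * indicator A x) \<in> borel_measurable leb01" for n by measurable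
  show "AE x in leb01. (\<lambda>n. (transfer ^^ n) f x * indicator A x) \<longlonglongrightarrow> inv_density x * indicator A x"
    by (rule AE_I2) (auto intro!: tendsto_mult_right funpow_transfer_tendsto[OF f])
  fix n
  have "\<bar>(transfer ^^ n) f x\<bar> \<le> exp 2" if "x \<in> {0..1}" for x
    using cone_mass_bounds(1)[OF cone_funpow_transfer[OF f(1), of n] _ that]
      cone_nonneg[OF cone_funpow_transfer[OF f(1), of n] that] mass_funpow_transfer[OF f(1), of n] f(2) by simp
  then show "AE x in leb01. norm ((transfer ^^ n) f x * indicator A x) \<le> exp 2"
    by (intro AE_I2) (auto simp: abs_mult split: split_indicator)
qed auto

lemma mass_inv_density: "mass inv_density = 1"
proof -
  have "(\<lambda>n. mass ((transfer ^^ n) (\<lambda>_. 1))) \<longlonglongrightarrow> mass inv_density"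
    using integral_funpow_transfer_tendsto[OF cone_one mass_one, of UNIV] by simp
  then show ?thesis using mass_funpow_transfer[OF cone_one] mass_one by (simp add: LIMSEQ_const_iff)
qed

lemma transfer_inv_density:
  assumes x: "x \<in> {0..1}" shows "transfer inv_density x = inv_density x"
proof -
  have "(\<lambda>n. (transfer ^^ Suc n) (\<lambda>_. 1) x) \<longlonglongrightarrow> transfer inv_density x"
    unfolding funpow.simps comp_def transfer_def[of inv_density] transfer_def[of "(transfer ^^ n) f" for n f]
    by (intro tendsto_sum tendsto_mult_left funpow_transfer_one_tendsto bolyai_inv_in x)
  moreover have "(\<lambda>n. (transfer ^^ Suc n) (\<lambda>_. 1) x) \<longlonglongrightarrow> inv_density x"
    using funpow_transfer_one_tendsto[OF x] by (rule LIMSEQ_Suc)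
  ultimately show ?thesis by (rule LIMSEQ_unique)
qed

section \<open>The invariant measure\<close>

definition bolyai_acim :: "real measure" where
  "bolyai_acim = density leb01 (\<lambda>x. ennreal (inv_density x))"

lemma inv_density_measurable [measurable]: "inv_density \<in> borel_measurable borel"
  by (rule cone_measurable[OF cone_inv_density])

lemma inv_density_bounds:
  assumes "x \<in> {0..1}" shows "exp (- 2) \<le> inv_density x" "inv_density x \<le> exp 2"
  using cone_mass_bounds[OF cone_inv_density _ assms] by (simp_all add: mass_inv_density exp_minus field_simps)

lemma inv_density_integrable: "integrable leb01 inv_density"
  by (rule cone_integrable[OF cone_inv_density]) simp

lemma sets_bolyai_acim [simp]: "sets bolyai_acim = sets leb01"
  and space_bolyai_acim [simp]: "space bolyai_acim = {0..1}"
  by (simp_all add: bolyai_acim_def)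

lemma emeasure_bolyai_acim:
  assumes A: "A \<in> sets leb01"
  shows "emeasure bolyai_acim A = (\<integral>\<^sup>+x. ennreal (inv_density x) * indicator A x \<partial>leb01)"
  unfolding bolyai_acim_def by (rule emeasure_density[OF _ A]) measurable

lemma integral_cone_indicator:
  assumes f: "cone K f" and A [measurable]: "A \<in> sets borel"
  shows "(\<integral>x. f x * indicator A x \<partial>leb01) = enn2real (\<integral>\<^sup>+x. ennreal (f x) * indicator A x \<partial>leb01)"
proof -
  note [measurable] = cone_measurable[OF f]
  have "(\<integral>x. f x * indicator A x \<partial>leb01) = enn2real (\<integral>\<^sup>+x. ennreal (f x * indicator A x) \<partial>leb01)"
  proof (rule integral_eq_nn_integral)
    show "AE x in leb01. 0 \<le> f x * indicator A x"
      using cone_nonneg[OF f] by (intro AE_I2) (auto intro!: mult_nonneg_nonneg)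
  qed measurable
  also have "(\<integral>\<^sup>+x. ennreal (f x * indicator A x) \<partial>leb01) = (\<integral>\<^sup>+x. ennreal (f x) * indicator A x \<partial>leb01)"
    by (rule nn_integral_cong) (simp split: split_indicator)
  finally show ?thesis .
qed

lemma measure_bolyai_acim:
  assumes A: "A \<in> sets leb01"
  shows "measure bolyai_acim A = (\<integral>x. inv_density x * indicator A x \<partial>leb01)"
  using A by (simp add: measure_def emeasure_bolyai_acim integral_cone_indicator[OF cone_inv_density] sets_leb01_iff)

lemma bolyai_T_measurable_leb01: "bolyai_T \<in> measurable leb01 leb01"
proof -
  have "bolyai_T \<in> measurable leb01 (restrict_space lborel {0..1})"
    by (rule measurable_restrict_space2) (use bolyai_T_in in auto)
  then show ?thesis by (simp add: leb01_def)
qed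

lemma emeasure_bolyai_acim_unit: "emeasure bolyai_acim {0..1} = 1"
proof -
  have "(\<integral>\<^sup>+x. ennreal (inv_density x) * indicator {0..1} x \<partial>leb01) = (\<integral>\<^sup>+x. ennreal (inv_density x) \<partial>leb01)"
    by (rule nn_integral_cong) simp
  also have "\<dots> = ennreal (mass inv_density)"
    using cone_nonneg[OF cone_inv_density]
    by (intro nn_integral_eq_integral inv_density_integrable AE_I2) auto
  finally show ?thesis using emeasure_bolyai_acim[of "{0..1}"] by (simp add: mass_inv_density sets_leb01_iff)
qed

lemma acim_bolyai_acim: "acim bolyai_acim"
  unfolding acim_def
proof (intro conjI)
  have mT: "bolyai_T \<in> measurable bolyai_acim bolyai_acim"
    using bolyai_T_measurable_leb01 by (simp cong: measurable_cong_sets)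
  then show "bolyai_T \<in> measurable bolyai_acim bolyai_acim" .
  show "prob_space bolyai_acim"
    by (rule prob_spaceI) (simp add: emeasure_bolyai_acim_unit)
  show "absolutely_continuous leb01 bolyai_acim"
    unfolding bolyai_acim_def by (rule absolutely_continuousI_density) measurable
  show "distr bolyai_acim bolyai_acim bolyai_T = bolyai_acim"
  proof (rule measure_eqI)
    fix A assume "A \<in> sets (distr bolyai_acim bolyai_acim bolyai_T)"
    then have A: "A \<in> sets leb01" by simp
    then have Ab [measurable]: "A \<in> sets borel" by (simp add: sets_leb01_iff)
    have pre: "bolyai_T -` A \<inter> {0..1} \<in> sets leb01"
      using measurable_sets[OF bolyai_T_measurable_leb01 A] by simp
    have "emeasure (distr bolyai_acim bolyai_acim bolyai_T) A = emeasure bolyai_acim (bolyai_T -` A \<inter> {0..1})"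
      using emeasure_distr[OF mT, of A] A by simp
    also have "\<dots> = (\<integral>\<^sup>+x. ennreal (inv_density x) * indicator (bolyai_T -` A \<inter> {0..1}) x \<partial>leb01)"
      by (rule emeasure_bolyai_acim[OF pre])
    also have "\<dots> = (\<integral>\<^sup>+x. ennreal (inv_density x) * indicator A (bolyai_T x) \<partial>leb01)"
      by (rule nn_integral_cong) (auto split: split_indicator)
    also have "\<dots> = (\<integral>\<^sup>+x. ennreal (transfer inv_density x) * indicator A x \<partial>leb01)"
      by (rule nn_integral_transfer_cone[OF cone_inv_density]) measurable
    also have "\<dots> = (\<integral>\<^sup>+x. ennreal (inv_density x) * indicator A x \<partial>leb01)"
      by (rule nn_integral_cong) (simp add: transfer_inv_density)
    finally show "emeasure (distr bolyai_acim bolyai_acim bolyai_T) A = emeasure bolyai_acim A"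
      by (simp add: emeasure_bolyai_acim[OF A])
  qed simp
qed simp

interpretation acim: measure_preserving bolyai_acim bolyai_T
  using acim_bolyai_acim by (simp add: acim_def measure_preserving_def measure_preserving_axioms_def)

text \<open>Points with a common itinerary are images under the same \<open>n\<close> inverse
  branches, each of which halves distances. This is what makes the cylinders generate the Borel
  sets.\<close>

lemma word_inj_contract:
  assumes "x \<in> {0..1}" "y \<in> {0..1}" "word n x = word n y"
  shows "\<bar>x - y\<bar> \<le> 1 / 2 ^ n"
  using assms
proof (induction n arbitrary: x y)
  case (Suc n)
  have d: "digit x = digit y" and w: "word n (bolyai_T x) = word n (bolyai_T y)"
    using Suc.prems(3) by (simp_all add: orbit_word_Suc)
  have "\<bar>x - y\<bar> = \<bar>bolyai_inv (digit x) (bolyai_T x) - bolyai_inv (digit x) (bolyai_T y)\<bar>"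
    using bolyai_inv_bolyai_T[OF Suc.prems(1)] bolyai_inv_bolyai_T[OF Suc.prems(2)] by (simp add: d)
  also have "\<dots> \<le> \<bar>bolyai_T x - bolyai_T y\<bar> / 2"
    by (rule bolyai_inv_contract[OF digit_in bolyai_T_in[OF Suc.prems(1)] bolyai_T_in[OF Suc.prems(2)]])
  also have "\<dots> \<le> (1 / 2 ^ n) / 2"
    using Suc.IH[OF bolyai_T_in[OF Suc.prems(1)] bolyai_T_in[OF Suc.prems(2)] w] by (intro divide_right_mono) auto
  finally show ?case by simp
qed auto

lemma word_set_measurable:
  assumes [measurable]: "E \<in> sets borel" shows "{x \<in> {0..1}. (x \<in> E) \<noteq> (word m x \<in> W)} \<in> sets leb01"
proof -
  have "{x \<in> space borel. x \<in> {0..1} \<and> (x \<in> E) \<noteq> (word m x \<in> W)} \<in> sets borel" by measurable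
  then show ?thesis by (auto simp: sets_leb01_iff)
qed

text \<open>Induction over the generation of the Borel sigma-algebra. The claim is made for all
  large \<open>m\<close>, not for one, because the union step needs approximations of several sets
  by cylinders of the same order.\<close>

lemma cylinder_approx:
  assumes "E \<in> sets borel" "0 < \<delta>"
  shows "\<exists>m0. \<forall>m\<ge>m0. \<exists>W. measure leb01 {x \<in> {0..1}. (x \<in> E) \<noteq> (word m x \<in> W)} < \<delta>"
proof -
  have "E \<in> sigma_sets UNIV {S. open S}"
    using assms(1) by (simp add: borel_def)
  then show ?thesis using assms(2)
  proof (induction arbitrary: \<delta>)
    case (Basic S)
    then have S: "open S" "S \<in> sets borel" by auto
    \<comment> \<open>An open set is approximated from inside, by the cylinders contained in it. The
      error sets decrease to the empty set because the cylinder of \<open>x\<close> eventually lies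
      in a ball around \<open>x\<close> inside \<open>S\<close>.\<close>
    define D where "D m = {x \<in> {0..1}. (x \<in> S) \<noteq> (word m x \<in> {w. \<forall>y\<in>{0..1}. word m y = w \<longrightarrow> y \<in> S})}" for m
    have D_eq: "D m = {x \<in> {0..1} \<inter> S. \<exists>y\<in>{0..1} - S. word m y = word m x}" for m
      unfolding D_def by auto
    have Dm: "D m \<in> sets leb01" for m
      unfolding D_def by (rule word_set_measurable[OF S(2)])
    have "(\<lambda>m. measure leb01 (D m)) \<longlonglongrightarrow> measure leb01 (\<Inter>m. D m)"
    proof (rule leb01.finite_Lim_measure_decseq)
      show "decseq D"
      proof (rule decseq_SucI, rule subsetI)
        fix m x assume "x \<in> D (Suc m)"
        then obtain y where "x \<in> {0..1} \<inter> S" "y \<in> {0..1} - S" "word (Suc m) y = word (Suc m) x"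
          unfolding D_eq by blast
        then show "x \<in> D m" unfolding D_eq by (auto simp: orbit_word_Suc_right)
      qed
    qed (use Dm in auto)
    also have "(\<Inter>m. D m) = {}"
    proof (rule ccontr)
      assume "(\<Inter>m. D m) \<noteq> {}"
      then obtain x where x: "\<And>m. x \<in> D m" by auto
      then have "x \<in> S" "x \<in> {0..1}" using D_eq by auto
      then obtain e where e: "e > 0" "ball x e \<subseteq> S" using S(1) openE by metis
      obtain m where m: "(1/2) ^ m < e" using real_arch_pow_inv[OF e(1), of "1/2"] by auto
      obtain y where y: "y \<in> {0..1}" "y \<notin> S" "word m y = word m x" using x[of m] D_eq by auto
      have "\<bar>x - y\<bar> \<le> 1 / 2 ^ m" using word_inj_contract[OF \<open>x \<in> {0..1}\<close> y(1)] y(3) by simp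
      also have "\<dots> < e" using m by (simp add: power_one_over)
      finally have "y \<in> ball x e" by (simp add: dist_real_def)
      then show False using e y by auto
    qed
    finally have "(\<lambda>m. measure leb01 (D m)) \<longlonglongrightarrow> 0" by simp
    then have "\<forall>\<^sub>F m in sequentially. measure leb01 (D m) < \<delta>" using Basic.prems by (rule order_tendstoD(2))
    then show ?case unfolding eventually_sequentially D_def by blast
  next
    case Empty
    have "{x \<in> {0..1::real}. (x \<in> {}) \<noteq> (word m x \<in> {})} = {}" for m by simp
    then show ?case using Empty by (intro exI[of _ 0] allI impI exI[of _ "{}"]) simp
  next
    case (Compl E)
    obtain m0 where m0: "\<And>m. m \<ge> m0 \<Longrightarrow> \<exists>W. measure leb01 {x \<in> {0..1}. (x \<in> E) \<noteq> (word m x \<in> W)} < \<delta>"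
      using Compl.IH[OF Compl.prems] by auto
    have eq: "{x \<in> {0..1}. (x \<in> UNIV - E) \<noteq> (word m x \<in> - W)} = {x \<in> {0..1}. (x \<in> E) \<noteq> (word m x \<in> W)}" for m W
      by auto
    show ?case
    proof (intro exI[of _ m0] allI impI)
      fix m assume "m \<ge> m0"
      then obtain W where "measure leb01 {x \<in> {0..1}. (x \<in> E) \<noteq> (word m x \<in> W)} < \<delta>" using m0 by blast
      then have "measure leb01 {x \<in> {0..1}. (x \<in> UNIV - E) \<noteq> (word m x \<in> - W)} < \<delta>" by (simp only: eq)
      then show "\<exists>W. measure leb01 {x \<in> {0..1}. (x \<in> UNIV - E) \<noteq> (word m x \<in> W)} < \<delta>" by blast
    qed
  next
    case (Union E)
    have Eb: "E i \<in> sets borel" for i using Union.hyps by (simp add: borel_def)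
    define R where "R N = {0..1} \<inter> ((\<Union>i. E i) - (\<Union>i<N. E i))" for N :: nat
    have Rm: "R N \<in> sets leb01" for N
      unfolding R_def sets_leb01_iff using Eb by auto
    have "(\<lambda>N. measure leb01 (R N)) \<longlonglongrightarrow> measure leb01 (\<Inter>N. R N)"
    proof (rule leb01.finite_Lim_measure_decseq)
      show "decseq R" unfolding R_def decseq_def by (auto intro: less_le_trans)
    qed (use Rm in auto)
    also have "(\<Inter>N. R N) = {}" by (auto simp: R_def)
    finally have "(\<lambda>N. measure leb01 (R N)) \<longlonglongrightarrow> 0" by simp
    then have "\<forall>\<^sub>F N in sequentially. measure leb01 (R N) < \<delta> / 2"
      using Union.prems by (intro order_tendstoD(2)) auto
    then obtain N where N: "measure leb01 (R N) < \<delta> / 2" by (auto simp: eventually_sequentially)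
    \<comment> \<open>Half of \<delta> pays for the tail \<open>R N\<close>, the other half is
      shared by the first \<open>N\<close> sets; \<open>Suc N\<close> covers
      \<open>N = 0\<close>.\<close>
    define \<gamma> where "\<gamma> = \<delta> / (2 * real (Suc N))"
    have \<gamma>: "0 < \<gamma>" using Union.prems by (simp add: \<gamma>_def)
    have "\<forall>i. \<exists>m0. \<forall>m\<ge>m0. \<exists>W. measure leb01 {x \<in> {0..1}. (x \<in> E i) \<noteq> (word m x \<in> W)} < \<gamma>"
      using Union.IH[OF \<gamma>] by blast
    then obtain m0 where m0: "\<And>i m. m \<ge> m0 i \<Longrightarrow> \<exists>W. measure leb01 {x \<in> {0..1}. (x \<in> E i) \<noteq> (word m x \<in> W)} < \<gamma>"
      by metis
    show ?case
    proof (intro exI[of _ "\<Sum>i<N. m0 i"] allI impI)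
      fix m assume m: "m \<ge> (\<Sum>i<N. m0 i)"
      have "m \<ge> m0 i" if "i < N" for i
        using m member_le_sum[of i "{..<N}" m0] that by auto
      then have "\<forall>i. \<exists>W. i < N \<longrightarrow> measure leb01 {x \<in> {0..1}. (x \<in> E i) \<noteq> (word m x \<in> W)} < \<gamma>"
        using m0 by blast
      then obtain W where W: "\<And>i. i < N \<Longrightarrow> measure leb01 {x \<in> {0..1}. (x \<in> E i) \<noteq> (word m x \<in> W i)} < \<gamma>"
        by metis
      let ?D = "\<lambda>i. {x \<in> {0..1}. (x \<in> E i) \<noteq> (word m x \<in> W i)}"
      have Dm: "?D i \<in> sets leb01" for i by (rule word_set_measurable[OF Eb])
      have "measure leb01 {x \<in> {0..1}. (x \<in> (\<Union>i. E i)) \<noteq> (word m x \<in> (\<Union>i<N. W i))}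
          \<le> measure leb01 (R N \<union> (\<Union>i<N. ?D i))"
        by (rule leb01.finite_measure_mono) (use Rm Dm in \<open>auto simp: R_def\<close>)
      also have "\<dots> \<le> measure leb01 (R N) + measure leb01 (\<Union>i<N. ?D i)"
        by (rule measure_subadditive) (use Rm Dm in auto)
      also have "measure leb01 (\<Union>i<N. ?D i) \<le> (\<Sum>i<N. measure leb01 (?D i))"
        by (rule leb01.finite_measure_subadditive_finite) (use Dm in auto)
      also have "\<dots> \<le> (\<Sum>i<N. \<gamma>)" using W by (intro sum_mono) (auto intro: less_imp_le)
      also have "\<dots> \<le> \<delta> / 2" using Union.prems by (simp add: \<gamma>_def field_simps)
      finally have "measure leb01 {x \<in> {0..1}. (x \<in> (\<Union>i. E i)) \<noteq> (word m x \<in> (\<Union>i<N. W i))} < \<delta>"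
        using N by linarith
      then show "\<exists>W. measure leb01 {x \<in> {0..1}. (x \<in> (\<Union>i. E i)) \<noteq> (word m x \<in> W)} < \<delta>" by blast
    qed
  qed
qed

section \<open>Mixing and uniqueness\<close>

lemma cone_word_deriv:
  assumes "set w \<subseteq> {1, 2, 3}" shows "cone 1 (word_deriv w)"
proof (rule coneI)
  show "0 \<le> word_deriv w x" if "x \<in> {0..1}" for x using word_deriv_pos[OF assms that] by simp
  fix x y :: real assume xy: "x \<in> {0..1}" "y \<in> {0..1}"
  have "word_deriv w x \<le> exp ((1 - 1 / 2 ^ length w) * \<bar>x - y\<bar>) * word_deriv w y"
    by (rule word_deriv_distortion[OF assms xy])
  also have "\<dots> \<le> exp (1 * \<bar>x - y\<bar>) * word_deriv w y"
    using word_deriv_pos[OF assms xy(2)] by (intro mult_right_mono) (auto simp: mult_left_le_one_le)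
  finally show "word_deriv w x \<le> exp (1 * \<bar>x - y\<bar>) * word_deriv w y" .
qed measurable

lemma mass_word_deriv_pos:
  assumes "set w \<subseteq> {1, 2, 3}" shows "0 < mass (word_deriv w)"
proof -
  have "0 < word_deriv w 0" by (rule word_deriv_pos[OF assms]) simp
  also have "\<dots> \<le> exp 1 * mass (word_deriv w)"
    by (rule cone_mass_bounds(1)[OF cone_word_deriv[OF assms]]) simp_all
  finally show ?thesis by (simp add: zero_less_mult_iff)
qed

lemma word_event_measurable:
  assumes [measurable]: "Measurable.pred borel P"
  shows "{x \<in> {0..1}. word m x \<in> W \<and> P x} \<in> sets leb01"
proof -
  have "{x \<in> space borel. x \<in> {0..1} \<and> word m x \<in> W \<and> P x} \<in> sets borel" by measurable
  then show ?thesis by (auto simp: sets_leb01_iff)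
qed

text \<open>After \<open>m\<close> steps Lebesgue measure on the cylinder is carried to the density
  \<open>word_deriv w\<close>; the remaining \<open>n\<close> steps act on this density by
  \<open>transfer\<close>.\<close>

lemma measure_cylinder_funpow:
  assumes w: "w \<in> words m" and A [measurable]: "A \<in> sets borel"
  shows "measure leb01 {x \<in> {0..1}. word m x = w \<and> (bolyai_T ^^ (n + m)) x \<in> A}
    = (\<integral>x. (transfer ^^ n) (word_deriv w) x * indicator A x \<partial>leb01)"
proof -
  let ?S = "{x \<in> {0..1}. word m x = w \<and> (bolyai_T ^^ (n + m)) x \<in> A}"
  have ws: "set w \<subseteq> {1, 2, 3}" using w by simp
  have c2: "cone 2 (word_deriv w)" by (rule cone_mono[OF cone_word_deriv[OF ws]]) simp
  have S: "?S \<in> sets leb01"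
    using word_event_measurable[of "\<lambda>x. (bolyai_T ^^ (n + m)) x \<in> A" m "{w}"] by simp
  have "emeasure leb01 ?S = (\<integral>\<^sup>+x. indicator ?S x \<partial>leb01)"
    using S by simp
  also have "\<dots> = (\<integral>\<^sup>+x. 1 * indicator {x. word m x = w} x * indicator A ((bolyai_T ^^ n) ((bolyai_T ^^ m) x)) \<partial>leb01)"
    by (rule nn_integral_cong) (auto simp: funpow_add split: split_indicator)
  also have "\<dots> = (\<integral>\<^sup>+x. 1 * ennreal (word_deriv w x) * indicator A ((bolyai_T ^^ n) x) \<partial>leb01)"
    by (rule nn_integral_cylinder[OF _ _ w]) measurable
  also have "\<dots> = (\<integral>\<^sup>+x. ennreal (word_deriv w x) * indicator A ((bolyai_T ^^ n) x) \<partial>leb01)"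
    by simp
  also have "\<dots> = (\<integral>\<^sup>+x. ennreal ((transfer ^^ n) (word_deriv w) x) * indicator A x \<partial>leb01)"
    by (rule nn_integral_funpow_transfer[OF c2]) measurable
  finally show ?thesis
    by (simp add: measure_def integral_cone_indicator[OF cone_funpow_transfer[OF c2] A])
qed

lemma measure_cylinder:
  assumes "w \<in> words m" shows "measure leb01 {x \<in> {0..1}. word m x = w} = mass (word_deriv w)"
  using measure_cylinder_funpow[OF assms, of UNIV 0] by simp

text \<open>Divided by its mass, \<open>word_deriv w\<close> is a mass-one element of
  \<open>cone 2\<close>, so its iterates tend to \<open>inv_density\<close>, whatever
  \<open>w\<close> is.\<close>

lemma mixing_cylinder:
  assumes w: "w \<in> words m" and A: "A \<in> sets leb01"
  shows "(\<lambda>n. measure leb01 {x \<in> {0..1}. word m x = w \<and> (bolyai_T ^^ n) x \<in> A})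
    \<longlonglongrightarrow> measure leb01 {x \<in> {0..1}. word m x = w} * measure bolyai_acim A"
proof -
  let ?p = "mass (word_deriv w)"
  have ws: "set w \<subseteq> {1, 2, 3}" and Ab: "A \<in> sets borel" using w A by (auto simp: sets_leb01_iff)
  note p = mass_word_deriv_pos[OF ws]
  define f where "f = (\<lambda>x. (1 / ?p) * word_deriv w x)"
  have f: "cone 2 f" unfolding f_def
    using p by (intro cone_scale cone_mono[OF cone_word_deriv[OF ws]]) simp_all
  have mf: "mass f = 1" using p by (simp add: f_def)
  \<comment> \<open>The summand \<open>0 * f x\<close> only gives the expression the shape of
    \<open>funpow_transfer_affine\<close>.\<close>
  have J: "word_deriv w = (\<lambda>x. ?p * f x + 0 * f x)" using p by (simp add: f_def)
  have "(transfer ^^ n) (word_deriv w) x = ?p * (transfer ^^ n) f x" for n x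
    by (subst J, subst funpow_transfer_affine) simp
  then have "(\<integral>x. (transfer ^^ n) (word_deriv w) x * indicator A x \<partial>leb01)
      = ?p * (\<integral>x. (transfer ^^ n) f x * indicator A x \<partial>leb01)" for n
    by (simp add: mult.assoc)
  then have "(\<lambda>n. measure leb01 {x \<in> {0..1}. word m x = w \<and> (bolyai_T ^^ (n + m)) x \<in> A})
      \<longlonglongrightarrow> ?p * measure bolyai_acim A"
    unfolding measure_cylinder_funpow[OF w Ab] measure_bolyai_acim[OF A]
    using integral_funpow_transfer_tendsto[OF f mf Ab] by (simp add: tendsto_mult_left)
  then show ?thesis unfolding measure_cylinder[OF w] by (rule LIMSEQ_offset)
qed

lemma mixing_cylinder_union:
  assumes A: "A \<in> sets leb01"
  shows "(\<lambda>n. measure leb01 {x \<in> {0..1}. word m x \<in> W \<and> (bolyai_T ^^ n) x \<in> A})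
    \<longlonglongrightarrow> measure leb01 {x \<in> {0..1}. word m x \<in> W} * measure bolyai_acim A"
proof -
  have Ab [measurable]: "A \<in> sets borel" using A by (simp add: sets_leb01_iff)
  have split: "measure leb01 {x \<in> {0..1}. word m x \<in> W \<and> P x}
      = (\<Sum>w\<in>words m \<inter> W. measure leb01 {x \<in> {0..1}. word m x = w \<and> P x})"
    if [measurable]: "Measurable.pred borel P" for P
  proof -
    have "{x \<in> {0..1}. word m x \<in> W \<and> P x} = (\<Union>w\<in>words m \<inter> W. {x \<in> {0..1}. word m x = w \<and> P x})"
      using word_in by auto
    moreover have "finite (words m \<inter> W)" by (rule finite_subset[OF _ finite_words[of m]]) auto
    then have "measure leb01 (\<Union>w\<in>words m \<inter> W. {x \<in> {0..1}. word m x = w \<and> P x})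
        = (\<Sum>w\<in>words m \<inter> W. measure leb01 {x \<in> {0..1}. word m x = w \<and> P x})"
      using word_event_measurable[OF that, of m "{w}" for w]
      by (intro leb01.finite_measure_finite_Union) (auto simp: disjoint_family_on_def)
    ultimately show ?thesis by simp
  qed
  have "(\<lambda>n. \<Sum>w\<in>words m \<inter> W. measure leb01 {x \<in> {0..1}. word m x = w \<and> (bolyai_T ^^ n) x \<in> A})
    \<longlonglongrightarrow> (\<Sum>w\<in>words m \<inter> W. measure leb01 {x \<in> {0..1}. word m x = w} * measure bolyai_acim A)"
    by (intro tendsto_sum mixing_cylinder A) simp
  moreover have "measure leb01 {x \<in> {0..1}. word m x \<in> W \<and> (bolyai_T ^^ n) x \<in> A}
     = (\<Sum>w\<in>words m \<inter> W. measure leb01 {x \<in> {0..1}. word m x = w \<and> (bolyai_T ^^ n) x \<in> A})" for n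
    by (rule split) measurable
  moreover have "measure leb01 {x \<in> {0..1}. word m x \<in> W} = (\<Sum>w\<in>words m \<inter> W. measure leb01 {x \<in> {0..1}. word m x = w})"
    using split[of "\<lambda>_. True"] by simp
  ultimately show ?thesis by (simp add: sum_distrib_right)
qed

lemma (in finite_measure) measure_diff_le_symdiff:
  assumes "A \<in> sets M" "B \<in> sets M" "S \<in> sets M" "A \<subseteq> B \<union> S" "B \<subseteq> A \<union> S"
  shows "\<bar>measure M A - measure M B\<bar> \<le> measure M S"
proof -
  have "measure M A \<le> measure M (B \<union> S)" "measure M B \<le> measure M (A \<union> S)"
    using assms by (auto intro!: finite_measure_mono)
  moreover have "measure M (B \<union> S) \<le> measure M B + measure M S" "measure M (A \<union> S) \<le> measure M A + measure M S"
    using assms by (auto intro!: measure_subadditive)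
  ultimately show ?thesis by linarith
qed

text \<open>Replacing \<open>E\<close> by a union of cylinders costs an error that is uniform in
  \<open>n\<close>.\<close>

lemma mixing:
  assumes A: "A \<in> sets leb01" and E: "E \<in> sets leb01"
  shows "(\<lambda>n. measure leb01 {x \<in> {0..1}. x \<in> E \<and> (bolyai_T ^^ n) x \<in> A})
    \<longlonglongrightarrow> measure leb01 E * measure bolyai_acim A"
proof (rule LIMSEQ_I)
  fix e :: real assume e: "0 < e"
  have Ab [measurable]: "A \<in> sets borel" and Eb [measurable]: "E \<in> sets borel" and E01: "E \<subseteq> {0..1}"
    using A E by (auto simp: sets_leb01_iff)
  obtain m W where W: "measure leb01 {x \<in> {0..1}. (x \<in> E) \<noteq> (word m x \<in> W)} < e / 3"
    using cylinder_approx[OF Eb, of "e / 3"] e by auto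
  let ?D = "{x \<in> {0..1}. (x \<in> E) \<noteq> (word m x \<in> W)}"
  let ?B = "{x \<in> {0..1}. word m x \<in> W}"
  let ?E = "\<lambda>n. {x \<in> {0..1}. x \<in> E \<and> (bolyai_T ^^ n) x \<in> A}"
  let ?F = "\<lambda>n. {x \<in> {0..1}. word m x \<in> W \<and> (bolyai_T ^^ n) x \<in> A}"
  have D: "?D \<in> sets leb01" by (rule word_set_measurable[OF Eb])
  have B: "?B \<in> sets leb01" using word_event_measurable[of "\<lambda>_. True" m W] by simp
  have F: "?F n \<in> sets leb01" for n by (rule word_event_measurable) measurable
  have En: "?E n \<in> sets leb01" for n
    using word_event_measurable[of "\<lambda>x. x \<in> E \<and> (bolyai_T ^^ n) x \<in> A" 0 UNIV] by simp
  have d1: "\<bar>measure leb01 (?E n) - measure leb01 (?F n)\<bar> \<le> measure leb01 ?D" for n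
    by (rule leb01.measure_diff_le_symdiff[OF En F D]) auto
  have d2: "\<bar>measure leb01 ?B - measure leb01 E\<bar> \<le> measure leb01 ?D"
    by (rule leb01.measure_diff_le_symdiff[OF B E D]) (use E01 in auto)
  have d3: "\<bar>measure leb01 ?B * measure bolyai_acim A - measure leb01 E * measure bolyai_acim A\<bar> \<le> measure leb01 ?D"
  proof -
    have "\<bar>measure leb01 ?B - measure leb01 E\<bar> * measure bolyai_acim A \<le> measure leb01 ?D * 1"
      using d2 by (intro mult_mono) auto
    then show ?thesis by (simp add: left_diff_distrib[symmetric] abs_mult)
  qed
  obtain N where N: "\<And>n. n \<ge> N \<Longrightarrow> \<bar>measure leb01 (?F n) - measure leb01 ?B * measure bolyai_acim A\<bar> < e / 3"
    using LIMSEQ_D[OF mixing_cylinder_union[OF A, of m W], of "e / 3"] e by auto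
  show "\<exists>N. \<forall>n\<ge>N. norm (measure leb01 (?E n) - measure leb01 E * measure bolyai_acim A) < e"
  proof (intro exI[of _ N] allI impI)
    fix n assume "n \<ge> N"
    then show "norm (measure leb01 (?E n) - measure leb01 E * measure bolyai_acim A) < e"
      using N[of n] d1[of n] d3 W unfolding real_norm_def by linarith
  qed
qed

text \<open>Extends \<open>mixing\<close> from indicators to integrable weights, because the density
  of a competing invariant measure is known only to be integrable. The limit step works since the
  integrals are 1-Lipschitz in the weight for the \<open>L^1\<close> distance, uniformly in
  \<open>n\<close>.\<close>

lemma mixing_integrable:
  assumes A: "A \<in> sets leb01" and h: "integrable leb01 h"
  shows "(\<lambda>n. \<integral>x. h x * indicator A ((bolyai_T ^^ n) x) \<partial>leb01)
    \<longlonglongrightarrow> (\<integral>x. h x \<partial>leb01) * measure bolyai_acim A"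
  using h
proof (induction rule: integrable_induct)
  have Ab [measurable]: "A \<in> sets borel" using A by (simp add: sets_leb01_iff)
  have ind_meas: "(\<lambda>x. indicator A ((bolyai_T ^^ n) x) :: real) \<in> borel_measurable leb01" for n by measurable
  have int: "integrable leb01 (\<lambda>x. f x * indicator A ((bolyai_T ^^ n) x))" if "integrable leb01 f" for f :: "real \<Rightarrow> real" and n
    by (rule Bochner_Integration.integrable_bound[OF that])
       (use ind_meas[of n] borel_measurable_integrable[OF that] in \<open>auto intro!: AE_I2 split: split_indicator\<close>)
  {
    case (base E c)
    have e1: "(\<integral>x. (indicator E x *\<^sub>R c) * indicator A ((bolyai_T ^^ n) x) \<partial>leb01)
        = c * measure leb01 {x \<in> {0..1}. x \<in> E \<and> (bolyai_T ^^ n) x \<in> A}" for n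
    proof -
      have Eb [measurable]: "E \<in> sets borel" using base by (simp add: sets_leb01_iff)
      have S: "{x \<in> {0..1}. x \<in> E \<and> (bolyai_T ^^ n) x \<in> A} \<in> sets leb01"
        using word_event_measurable[of "\<lambda>x. x \<in> E \<and> (bolyai_T ^^ n) x \<in> A" 0 UNIV] by simp
      have "(\<integral>x. (indicator E x *\<^sub>R c) * indicator A ((bolyai_T ^^ n) x) \<partial>leb01)
          = (\<integral>x. c * indicator {x \<in> {0..1}. x \<in> E \<and> (bolyai_T ^^ n) x \<in> A} x \<partial>leb01)"
        by (rule Bochner_Integration.integral_cong) (auto split: split_indicator)
      also have "\<dots> = c * measure leb01 {x \<in> {0..1}. x \<in> E \<and> (bolyai_T ^^ n) x \<in> A}"
        using sets.sets_into_space[OF S] by (simp add: Int_absorb2)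
      finally show ?thesis .
    qed
    have e2: "(\<integral>x. indicator E x *\<^sub>R c \<partial>leb01) = c * measure leb01 E"
      using base sets.sets_into_space[OF base(1)] by (simp add: Int_absorb2 mult.commute)
    show ?case
      unfolding e1 e2 mult.assoc by (rule tendsto_mult_left[OF mixing[OF A base(1)]])
  next
    case (add f g)
    have "(\<integral>x. (f x + g x) * indicator A ((bolyai_T ^^ n) x) \<partial>leb01)
       = (\<integral>x. f x * indicator A ((bolyai_T ^^ n) x) \<partial>leb01) + (\<integral>x. g x * indicator A ((bolyai_T ^^ n) x) \<partial>leb01)" for n
      unfolding distrib_right by (rule Bochner_Integration.integral_add[OF int int]) (use add in auto)
    moreover have "(\<integral>x. f x + g x \<partial>leb01) = (\<integral>x. f x \<partial>leb01) + (\<integral>x. g x \<partial>leb01)"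
      using add by (intro Bochner_Integration.integral_add)
    ultimately show ?case using tendsto_add[OF add.IH] by (simp add: distrib_right)
  next
    case (lim f s)
    have fs: "integrable leb01 (\<lambda>x. \<bar>s i x - f x\<bar>)" for i using lim.hyps(1)[of i] lim.hyps(4) by auto
    have "(\<lambda>i. \<integral>x. \<bar>s i x - f x\<bar> \<partial>leb01) \<longlonglongrightarrow> (\<integral>x. 0 \<partial>leb01)"
    \<comment> \<open>The induction rule supplies
      \<open>\<bar>s i x\<bar> \<le> 2 * \<bar>f x\<bar>\<close>; adding
      \<open>\<bar>f x\<bar>\<close> gives the factor 3.\<close>
    proof (rule integral_dominated_convergence[where w="\<lambda>x. 3 * \<bar>f x\<bar>"])
      show "AE x in leb01. (\<lambda>i. \<bar>s i x - f x\<bar>) \<longlonglongrightarrow> 0"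
      proof (rule AE_I2)
        fix x assume "x \<in> space leb01"
        then have "(\<lambda>i. s i x - f x) \<longlonglongrightarrow> 0" using lim.hyps(2)[of x] by (simp add: LIM_zero)
        then show "(\<lambda>i. \<bar>s i x - f x\<bar>) \<longlonglongrightarrow> 0" by (rule tendsto_rabs_zero)
      qed
      show "AE x in leb01. norm \<bar>s i x - f x\<bar> \<le> 3 * \<bar>f x\<bar>" for i
      proof (rule AE_I2)
        fix x assume "x \<in> space leb01"
        then have "\<bar>s i x\<bar> \<le> 2 * \<bar>f x\<bar>" using lim.hyps(3)[of x i] by simp
        then show "norm \<bar>s i x - f x\<bar> \<le> 3 * \<bar>f x\<bar>" by simp
      qed
      show "integrable leb01 (\<lambda>x. 3 * \<bar>f x\<bar>)" using lim.hyps(4) by auto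
    qed (use fs borel_measurable_integrable in auto)
    then have L1: "(\<lambda>i. \<integral>x. \<bar>s i x - f x\<bar> \<partial>leb01) \<longlonglongrightarrow> 0" by simp
    have close: "\<bar>(\<integral>x. s i x * u x \<partial>leb01) - (\<integral>x. f x * u x \<partial>leb01)\<bar> \<le> (\<integral>x. \<bar>s i x - f x\<bar> \<partial>leb01)"
      if u: "\<And>x. 0 \<le> u x \<and> u x \<le> 1" "integrable leb01 (\<lambda>x. s i x * u x)" "integrable leb01 (\<lambda>x. f x * u x)"
      for i and u :: "real \<Rightarrow> real"
    proof -
      have "(\<integral>x. s i x * u x \<partial>leb01) - (\<integral>x. f x * u x \<partial>leb01) = (\<integral>x. s i x * u x - f x * u x \<partial>leb01)"
        using u by simp
      also have "\<bar>\<dots>\<bar> \<le> (\<integral>x. \<bar>s i x * u x - f x * u x\<bar> \<partial>leb01)" by (rule integral_abs_bound)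
      also have "\<dots> \<le> (\<integral>x. \<bar>s i x - f x\<bar> \<partial>leb01)"
      proof (rule integral_mono)
        show "integrable leb01 (\<lambda>x. \<bar>s i x * u x - f x * u x\<bar>)" using u by auto
        fix x
        have "\<bar>s i x - f x\<bar> * u x \<le> \<bar>s i x - f x\<bar> * 1" using u(1)[of x] by (intro mult_left_mono) auto
        then show "\<bar>s i x * u x - f x * u x\<bar> \<le> \<bar>s i x - f x\<bar>"
          using u(1)[of x] by (simp add: left_diff_distrib[symmetric] abs_mult)
      qed (rule fs)
      finally show ?thesis .
    qed
    show ?case
    proof (rule LIMSEQ_I)
      fix e :: real assume e: "0 < e"
      obtain i where i: "(\<integral>x. \<bar>s i x - f x\<bar> \<partial>leb01) < e / 3"
        using order_tendstoD(2)[OF L1, of "e / 3"] e by (auto simp: eventually_sequentially)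
      let ?I = "\<lambda>f n. \<integral>x. f x * indicator A ((bolyai_T ^^ n) x) \<partial>leb01"
      let ?\<mu> = "measure bolyai_acim A"
      have c1: "\<bar>?I (s i) n - ?I f n\<bar> < e / 3" for n
        using close[of "\<lambda>x. indicator A ((bolyai_T ^^ n) x)" i] int[OF lim.hyps(1)[of i], of n] int[OF lim.hyps(4), of n] i
        by (simp split: split_indicator)
      have "\<bar>mass (s i) - mass f\<bar> < e / 3" using close[of "\<lambda>_. 1" i] lim.hyps(1)[of i] lim.hyps(4) i by simp
      moreover have "\<bar>mass (s i) - mass f\<bar> * ?\<mu> \<le> \<bar>mass (s i) - mass f\<bar> * 1" by (intro mult_left_mono) auto
      ultimately have c2: "\<bar>mass (s i) * ?\<mu> - mass f * ?\<mu>\<bar> < e / 3"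
        by (simp add: left_diff_distrib[symmetric] abs_mult)
      obtain N where N: "\<And>n. n \<ge> N \<Longrightarrow> \<bar>?I (s i) n - mass (s i) * ?\<mu>\<bar> < e / 3"
        using LIMSEQ_D[OF lim.IH[of i], of "e / 3"] e by auto
      show "\<exists>N. \<forall>n\<ge>N. norm (?I f n - mass f * ?\<mu>) < e"
      proof (intro exI[of _ N] allI impI)
        fix n assume "n \<ge> N"
        then show "norm (?I f n - mass f * ?\<mu>) < e"
          using N[of n] c1[of n] c2 unfolding real_norm_def by linarith
      qed
    qed
  }
qed

text \<open>For an invariant measure with density \<open>h\<close>, the integral of \<open>h\<close>
  against the indicator of \<open>A\<close> at time \<open>n\<close> does not depend on
  \<open>n\<close>, while mixing forces it to tend to the \<open>bolyai_acim\<close>-measure of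
  \<open>A\<close>.\<close>

lemma acim_unique:
  assumes M: "acim M" shows "M = bolyai_acim"
proof -
  have sets: "sets M = sets leb01" and ac: "absolutely_continuous leb01 M"
    and T: "bolyai_T \<in> measurable M M" and inv: "distr M M bolyai_T = M" and pM: "prob_space M"
    using M by (auto simp: acim_def)
  interpret M: measure_preserving M bolyai_T
    using pM T inv by (simp add: measure_preserving_def measure_preserving_axioms_def)
  have spM: "space M = {0..1}" using sets_eq_imp_space_eq[OF sets] by simp
  define h where "h = (\<lambda>x. enn2real (RN_deriv leb01 M x))"
  have dM: "density leb01 (RN_deriv leb01 M) = M" by (rule leb01.density_RN_deriv[OF ac sets])
  have hm: "h \<in> borel_measurable leb01" unfolding h_def by measurable
  have fin: "AE x in leb01. RN_deriv leb01 M x \<noteq> \<infinity>"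
    by (rule leb01.RN_deriv_finite[OF M.sigma_finite_measure_axioms ac sets])
  have M_eq: "M = density leb01 (\<lambda>x. ennreal (h x))"
  proof -
    have "density leb01 (RN_deriv leb01 M) = density leb01 (\<lambda>x. ennreal (h x))"
    proof (rule density_cong)
      show "AE x in leb01. RN_deriv leb01 M x = ennreal (h x)"
        using fin by eventually_elim (simp add: h_def ennreal_enn2real_if)
    qed (use hm in measurable)
    then show ?thesis by (simp add: dM)
  qed
  have mM: "measure M S = (\<integral>x. h x * indicator S x \<partial>leb01)" if S: "S \<in> sets leb01" for S
  proof -
    have "emeasure M S = (\<integral>\<^sup>+x. ennreal (h x) * indicator S x \<partial>leb01)"
      by (subst M_eq, rule emeasure_density[OF _ S]) (use hm in measurable)
    also have "\<dots> = (\<integral>\<^sup>+x. ennreal (h x * indicator S x) \<partial>leb01)"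
      by (rule nn_integral_cong) (simp split: split_indicator)
    finally have "measure M S = enn2real (\<integral>\<^sup>+x. ennreal (h x * indicator S x) \<partial>leb01)" by (simp add: measure_def)
    also have "\<dots> = (\<integral>x. h x * indicator S x \<partial>leb01)"
      by (rule integral_eq_nn_integral[symmetric]) (use S hm in \<open>auto simp: h_def intro!: AE_I2\<close>)
    finally show ?thesis .
  qed
  have "emeasure M {0..1} = (\<integral>\<^sup>+x. ennreal (h x) * indicator {0..1} x \<partial>leb01)"
    by (subst M_eq, rule emeasure_density) (use hm in \<open>auto simp: sets_leb01_iff\<close>)
  also have "\<dots> = (\<integral>\<^sup>+x. ennreal (h x) \<partial>leb01)" by (rule nn_integral_cong) simp
  finally have nnh: "(\<integral>\<^sup>+x. ennreal (h x) \<partial>leb01) = 1" using M.emeasure_space_1 by (simp add: spM)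
  have hint: "integrable leb01 h"
    by (rule integrableI_nonneg[OF hm]) (auto simp: h_def nnh[unfolded h_def] intro!: AE_I2)
  have hmass: "mass h = 1"
    using integral_eq_nn_integral[OF hm] nnh by (simp add: h_def)
  show ?thesis
  proof (rule measure_eqI)
    fix A assume "A \<in> sets M"
    then have A: "A \<in> sets leb01" by (simp add: sets)
    have const: "(\<integral>x. h x * indicator A ((bolyai_T ^^ n) x) \<partial>leb01) = measure M A" for n
    proof -
      have S: "(bolyai_T ^^ n) -` A \<inter> space M \<in> sets M"
        using measurable_sets[OF M.funpow_measurable \<open>A \<in> sets M\<close>] .
      have "measure M A = measure M ((bolyai_T ^^ n) -` A \<inter> space M)"
        using M.prob_vimage_T[OF \<open>A \<in> sets M\<close>] by simp
      also have "\<dots> = (\<integral>x. h x * indicator ((bolyai_T ^^ n) -` A \<inter> space M) x \<partial>leb01)"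
        by (rule mM) (use S sets in simp)
      also have "\<dots> = (\<integral>x. h x * indicator A ((bolyai_T ^^ n) x) \<partial>leb01)"
        by (rule Bochner_Integration.integral_cong) (auto simp: spM split: split_indicator)
      finally show ?thesis by simp
    qed
    have "measure M A = measure bolyai_acim A"
      using mixing_integrable[OF A hint] unfolding const by (simp add: hmass LIMSEQ_const_iff)
    then show "emeasure M A = emeasure bolyai_acim A"
      by (simp add: M.emeasure_eq_measure acim.emeasure_eq_measure)
  qed (simp add: sets)
qed

lemma bolyai_mu_eq: "bolyai_mu = bolyai_acim"
  unfolding bolyai_mu_def by (rule the_equality) (rule acim_bolyai_acim, erule acim_unique)

section \<open>Entropy bounds\<close>

text \<open>Jensen's inequality for \<open>ln\<close>, with the sum replaced by any upper bound \<open>s\<close>.\<close>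
lemma (in prob_space) ent_power_sum_bound:
  assumes X: "simple_function M X" and pos: "\<And>v. v \<in> X ` space M \<Longrightarrow> 0 < pr X v"
    and s: "(\<Sum>v\<in>X ` space M. pr X v powr (1 + t)) \<le> s" "0 < s"
  shows "- t * ent X \<le> ln s"
proof -
  have "pr X v * (t * ln (pr X v)) \<le> pr X v powr (1 + t) / s + pr X v * (ln s - 1)" if "v \<in> X ` space M" for v
  proof -
    note p = pos[OF that]
    \<comment> \<open>The tangent of \<open>ln\<close> at \<open>s\<close>. Weighted by the
      probabilities and summed, it leaves at most \<open>ln s\<close>, because the power sum divided
      by \<open>s\<close> is at most 1.\<close>
    have "ln (pr X v powr t / s) \<le> pr X v powr t / s - 1"
      using p s(2) by (intro ln_le_minus_one) simp
    then have "t * ln (pr X v) \<le> pr X v powr t / s + (ln s - 1)"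
      using p s(2) by (simp add: ln_div ln_powr)
    then have "pr X v * (t * ln (pr X v)) \<le> pr X v * (pr X v powr t / s + (ln s - 1))"
      using p by (intro mult_left_mono) auto
    then show ?thesis using p by (simp add: powr_add distrib_left)
  qed
  then have "(\<Sum>v\<in>X ` space M. pr X v * (t * ln (pr X v)))
      \<le> (\<Sum>v\<in>X ` space M. pr X v powr (1 + t) / s + pr X v * (ln s - 1))"
    by (rule sum_mono)
  also have "\<dots> = (\<Sum>v\<in>X ` space M. pr X v powr (1 + t)) / s + (ln s - 1)"
    using sum_pr[OF X] by (simp add: sum.distrib sum_divide_distrib[symmetric] sum_distrib_right[symmetric])
  also have "\<dots> \<le> ln s" using s by simp
  finally have *: "(\<Sum>v\<in>X ` space M. pr X v * (t * ln (pr X v))) \<le> ln s" .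
  have "- t * ent X = (\<Sum>v\<in>X ` space M. pr X v * (t * ln (pr X v)))"
    unfolding ent_def sum_distrib_left by (rule sum.cong) (auto simp: ent_phi_def)
  with * show ?thesis by simp
qed

section \<open>Power sums over words\<close>

lemma sum_words_Suc:
  "(\<Sum>w\<in>words (Suc n). F w) = (\<Sum>w\<in>words n. \<Sum>i\<in>{1,2,3}. F (i # w))"
proof -
  have "(\<Sum>w\<in>words n. \<Sum>i\<in>{1,2,3::nat}. F (i # w)) = (\<Sum>(w, i)\<in>words n \<times> {1,2,3}. F (i # w))"
    by (rule sum.cartesian_product)
  also have "\<dots> = (\<Sum>w\<in>words (Suc n). F w)"
    by (rule sum.reindex_bij_witness[where i="\<lambda>w. (tl w, hd w)" and j="\<lambda>(w, i). i # w"])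
       (auto simp: length_Suc_conv)
  finally show ?thesis by simp
qed

lemma transfer_op_eq:
  assumes "x \<in> {0..1}"
  shows "transfer_op t g x = (\<Sum>i\<in>{1,2,3}. inv_deriv i x powr (1 + t) * g (bolyai_inv i x))"
  unfolding transfer_op_def
proof (rule sum.cong[OF refl])
  fix i :: nat assume i: "i \<in> {1, 2, 3}"
  have "deriv (bolyai_inv i) x = inv_deriv i x"
    by (rule DERIV_imp_deriv[OF bolyai_inv_has_deriv[OF i assms]])
  then show "\<bar>deriv (bolyai_inv i) x\<bar> powr (1 + t) * g (bolyai_inv i x) = inv_deriv i x powr (1 + t) * g (bolyai_inv i x)"
    using inv_deriv_nonneg[OF i assms] by simp
qed

text \<open>The sum is the \<open>n\<close>-th iterate of \<open>transfer_op t\<close> on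
  \<open>g\<close>, evaluated at \<open>x\<close>. A new letter is put in front, so the hypothesis
  is used at the points \<open>inv_word w x\<close>.\<close>

lemma word_sum_le:
  assumes step: "\<And>x. x \<in> {0..1} \<Longrightarrow> transfer_op t g x \<le> \<kappa> * g x" and \<kappa>: "0 \<le> \<kappa>" and x: "x \<in> {0..1}"
  shows "(\<Sum>w\<in>words n. word_deriv w x powr (1 + t) * g (inv_word w x)) \<le> \<kappa> ^ n * g x"
proof (induction n)
  case 0
  have "words 0 = {[]}" by auto
  then show ?case by simp
next
  case (Suc n)
  have "(\<Sum>w\<in>words (Suc n). word_deriv w x powr (1 + t) * g (inv_word w x))
      = (\<Sum>w\<in>words n. word_deriv w x powr (1 + t) * transfer_op t g (inv_word w x))"
    unfolding sum_words_Suc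
  proof (rule sum.cong[OF refl])
    fix w assume "w \<in> words n"
    then have w: "set w \<subseteq> {1, 2, 3}" by simp
    note xw = inv_word_in[OF w x]
    show "(\<Sum>i\<in>{1,2,3}. word_deriv (i # w) x powr (1 + t) * g (inv_word (i # w) x))
        = word_deriv w x powr (1 + t) * transfer_op t g (inv_word w x)"
      unfolding transfer_op_eq[OF xw] sum_distrib_left
    proof (rule sum.cong[OF refl])
      fix i :: nat assume i: "i \<in> {1, 2, 3}"
      show "word_deriv (i # w) x powr (1 + t) * g (inv_word (i # w) x)
        = word_deriv w x powr (1 + t) * (inv_deriv i (inv_word w x) powr (1 + t) * g (bolyai_inv i (inv_word w x)))"
        using word_deriv_pos[OF w x] inv_deriv_nonneg[OF i xw] by (simp add: powr_mult mult_ac)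
    qed
  qed
  also have "\<dots> \<le> (\<Sum>w\<in>words n. word_deriv w x powr (1 + t) * (\<kappa> * g (inv_word w x)))"
    using x by (intro sum_mono mult_left_mono step inv_word_in) auto
  also have "\<dots> = \<kappa> * (\<Sum>w\<in>words n. word_deriv w x powr (1 + t) * g (inv_word w x))"
    by (simp add: sum_distrib_left mult_ac)
  also have "\<dots> \<le> \<kappa> * (\<kappa> ^ n * g x)" using Suc \<kappa> by (intro mult_left_mono)
  finally show ?case by (simp add: mult_ac)
qed

lemma simple_function_digit: "simple_function bolyai_acim digit"
  unfolding simple_function_def
proof (intro conjI ballI)
  show "finite (digit ` space bolyai_acim)"
    by (rule finite_subset[of _ "{1, 2, 3}"]) (use digit_in in auto)
  fix v
  have "{x \<in> space borel. x \<in> {0..1} \<and> digit x = v} \<in> sets borel" by measurable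
  moreover have "digit -` {v} \<inter> space bolyai_acim = {x \<in> space borel. x \<in> {0..1} \<and> digit x = v}" by auto
  ultimately show "digit -` {v} \<inter> space bolyai_acim \<in> sets bolyai_acim" by (auto simp: sets_leb01_iff)
qed

lemma measure_bolyai_acim_bounds:
  assumes S: "S \<in> sets leb01"
  shows "exp (- 2) * measure leb01 S \<le> measure bolyai_acim S" "measure bolyai_acim S \<le> exp 2 * measure leb01 S"
proof -
  have [measurable]: "S \<in> sets borel" and S01: "S \<inter> {0..1} = S" using S by (auto simp: sets_leb01_iff)
  have eq: "(\<integral>x. c * indicator S x \<partial>leb01) = c * measure leb01 S" for c :: real
    using S01 by simp
  have int: "integrable leb01 (\<lambda>x. c * indicator S x)" for c :: real
    by (rule integrable_bounded_leb01[of _ "\<bar>c\<bar>"]) (measurable, simp split: split_indicator)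
  have int2: "integrable leb01 (\<lambda>x. inv_density x * indicator S x)"
  proof (rule integrable_bounded_leb01)
    show "\<bar>inv_density x * indicator S x\<bar> \<le> exp 2" if "x \<in> {0..1}" for x
      using inv_density_bounds(2)[OF that] cone_nonneg[OF cone_inv_density that] by (simp split: split_indicator)
  qed measurable
  have "(\<integral>x. exp (- 2) * indicator S x \<partial>leb01) \<le> (\<integral>x. inv_density x * indicator S x \<partial>leb01)"
    by (rule integral_mono[OF int int2]) (use inv_density_bounds(1) in \<open>simp split: split_indicator\<close>)
  then show "exp (- 2) * measure leb01 S \<le> measure bolyai_acim S"
    unfolding eq measure_bolyai_acim[OF S] .
  have "(\<integral>x. inv_density x * indicator S x \<partial>leb01) \<le> (\<integral>x. exp 2 * indicator S x \<partial>leb01)"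
    by (rule integral_mono[OF int2 int]) (use inv_density_bounds(2) in \<open>simp split: split_indicator\<close>)
  then show "measure bolyai_acim S \<le> exp 2 * measure leb01 S"
    unfolding eq measure_bolyai_acim[OF S] .
qed

text \<open>The constant 3 is 2 from the bounds on the invariant density plus 1 from the distortion
  of \<open>word_deriv w\<close>, which lets its mass be replaced by its value at 0.\<close>

lemma pr_word_bounds:
  assumes w: "w \<in> words n"
  shows "exp (- 3) * word_deriv w 0 \<le> acim.pr (word n) w" "acim.pr (word n) w \<le> exp 3 * word_deriv w 0"
proof -
  have ws: "set w \<subseteq> {1, 2, 3}" using w by simp
  have S: "{x \<in> {0..1}. word n x = w} \<in> sets leb01"
    using word_event_measurable[of "\<lambda>_. True" n "{w}"] by simp
  have "word n -` {w} \<inter> space bolyai_acim = {x \<in> {0..1}. word n x = w}" by auto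
  then have pr: "acim.pr (word n) w = measure bolyai_acim {x \<in> {0..1}. word n x = w}"
    by (simp add: acim.pr_def)
  note b = measure_bolyai_acim_bounds[OF S, unfolded measure_cylinder[OF w]]
  note c = cone_mass_bounds[OF cone_word_deriv[OF ws], of 0, simplified]
  have "exp (- 3) * word_deriv w 0 = exp (- 2) * (exp (- 1) * word_deriv w 0)"
    by (simp add: mult.assoc[symmetric] exp_add[symmetric])
  also have "\<dots> \<le> exp (- 2) * mass (word_deriv w)"
    using c(1) by (intro mult_left_mono) (simp_all add: exp_minus field_simps)
  finally show "exp (- 3) * word_deriv w 0 \<le> acim.pr (word n) w" using b(1) pr by simp
  have "exp 2 * mass (word_deriv w) \<le> exp 2 * (exp 1 * word_deriv w 0)"
    using c(2) by (intro mult_left_mono) simp_all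
  also have "\<dots> = exp 3 * word_deriv w 0" by (simp add: mult.assoc[symmetric] exp_add[symmetric])
  finally show "acim.pr (word n) w \<le> exp 3 * word_deriv w 0" using b(2) pr by simp
qed

text \<open>The absolute value is there because the exponent \<open>1 + t\<close> is negative for
  \<open>t < - 1\<close>, which \<open>t = - \<epsilon>\<close> permits.\<close>

lemma powr_le_of_ratio_bounds:
  fixes p q :: real
  assumes "0 < q" "exp (- 3) * q \<le> p" "p \<le> exp 3 * q"
  shows "p powr a \<le> exp (3 * \<bar>a\<bar>) * q powr a"
proof -
  have p: "0 < p" using assms(1,2) by (meson exp_gt_zero less_le_trans mult_pos_pos)
  have "ln (exp (- 3) * q) \<le> ln p" "ln p \<le> ln (exp 3 * q)" using assms p by (auto intro!: ln_mono)
  then have "\<bar>ln p - ln q\<bar> \<le> 3" using assms(1) by (simp add: ln_mult)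
  then have "\<bar>a\<bar> * \<bar>ln p - ln q\<bar> \<le> \<bar>a\<bar> * 3" by (intro mult_left_mono) auto
  then have "a * (ln p - ln q) \<le> 3 * \<bar>a\<bar>"
    using abs_ge_self[of "a * (ln p - ln q)"] by (simp add: abs_mult mult.commute)
  then have "a * ln p \<le> 3 * \<bar>a\<bar> + a * ln q" by (simp add: right_diff_distrib)
  then have "exp (a * ln p) \<le> exp (3 * \<bar>a\<bar> + a * ln q)" by simp
  then show ?thesis using p assms(1) by (simp add: powr_def exp_add)
qed

text \<open>A real-valued \<open>SUP\<close> is known to bound its members only when the set is
  bounded above; this comes from continuity on a compact interval, checked for the closed form of
  the operator.\<close>

lemma transfer_op_le_of_SUP:
  assumes g: "continuous_on {0..1} g" "\<forall>x\<in>{0..1}. g x > 0"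
    and sup: "(SUP x\<in>{0..1}. transfer_op t g x / g x) \<le> \<kappa>" and x: "x \<in> {0..1}"
  shows "transfer_op t g x \<le> \<kappa> * g x"
proof -
  have cont: "continuous_on {0..1} (\<lambda>x. (\<Sum>i\<in>{1,2,3}. inv_deriv i x powr (1 + t) * g (bolyai_inv i x)) / g x)"
  proof (intro continuous_on_divide continuous_on_sum continuous_on_mult continuous_on_powr g continuous_on_const ballI)
    fix i :: nat assume i: "i \<in> {1, 2, 3}"
    show "continuous_on {0..1} (inv_deriv i)"
      unfolding inv_deriv_def[abs_def] using i by (auto intro!: continuous_intros)
    show "inv_deriv i x \<noteq> 0" if "x \<in> {0..1}" for x using inv_deriv_bounds(1)[OF i that] by auto
    have "continuous_on {0..1} (bolyai_inv i)"
      unfolding bolyai_inv_def[abs_def] by (intro continuous_intros)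
    then show "continuous_on {0..1} (\<lambda>x. g (bolyai_inv i x))"
      by (rule continuous_on_compose2[OF g(1)]) (use bolyai_inv_in[OF i] in auto)
  qed (use g(2) in force)
  have "bdd_above ((\<lambda>x. (\<Sum>i\<in>{1,2,3}. inv_deriv i x powr (1 + t) * g (bolyai_inv i x)) / g x) ` {0..1})"
    by (intro bounded_imp_bdd_above compact_imp_bounded compact_continuous_image[OF cont]) simp
  moreover have "(\<lambda>x. (\<Sum>i\<in>{1,2,3}. inv_deriv i x powr (1 + t) * g (bolyai_inv i x)) / g x) ` {0..1}
      = (\<lambda>x. transfer_op t g x / g x) ` {0..1}"
    by (rule image_cong[OF refl]) (simp only: transfer_op_eq)
  ultimately have "bdd_above ((\<lambda>x. transfer_op t g x / g x) ` {0..1})" by simp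
  then have "transfer_op t g x / g x \<le> \<kappa>" using cSUP_upper[OF x] sup by (meson order_trans)
  then show ?thesis using g(2) x by (simp add: divide_le_eq)
qed

lemma ent_word_bound:
  assumes g: "continuous_on {0..1} g" "\<forall>x\<in>{0..1}. g x > 0"
    and sup: "(SUP x\<in>{0..1}. transfer_op t g x / g x) \<le> exp \<gamma>"
  shows "\<exists>C. \<forall>n. - t * acim.ent (word n) \<le> C + real n * \<gamma>"
proof -
  obtain z where z: "z \<in> {0..1}" "\<And>x. x \<in> {0..1} \<Longrightarrow> g z \<le> g x"
    using continuous_attains_inf[of "{0..1::real}" g] g(1) by auto
  have gz: "0 < g z" "0 < g 0" using g(2) z(1) by auto
  \<comment> \<open>The first factor pays for replacing cylinder measures by derivatives at 0; the
    second pays for inserting \<open>g (inv_word w 0) / g z \<ge> 1\<close> and for the value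
    \<open>g 0\<close> that \<open>word_sum_le\<close> leaves behind.\<close>
  define B where "B = exp (3 * \<bar>1 + t\<bar>) * (g 0 / g z)"
  have B: "0 < B" using gz by (simp add: B_def)
  have "- t * acim.ent (word n) \<le> ln B + real n * \<gamma>" for n
  proof -
    have sw: "simple_function bolyai_acim (word n)"
      by (rule acim.simple_function_orbit_word[OF simple_function_digit])
    have img: "word n ` space bolyai_acim \<subseteq> words n" using word_in by auto
    have wd: "0 < word_deriv w 0" if "w \<in> words n" for w using word_deriv_pos[of w 0] that by simp
    have "(\<Sum>w\<in>word n ` space bolyai_acim. acim.pr (word n) w powr (1 + t))
        \<le> (\<Sum>w\<in>words n. acim.pr (word n) w powr (1 + t))"
      by (rule sum_mono2[OF finite_words img]) simp
    also have "\<dots> \<le> (\<Sum>w\<in>words n. exp (3 * \<bar>1 + t\<bar>) * word_deriv w 0 powr (1 + t))"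
      by (intro sum_mono powr_le_of_ratio_bounds wd pr_word_bounds)
    also have "\<dots> \<le> (\<Sum>w\<in>words n. exp (3 * \<bar>1 + t\<bar>) / g z * (word_deriv w 0 powr (1 + t) * g (inv_word w 0)))"
    proof (rule sum_mono)
      fix w assume w: "w \<in> words n"
      have "g z \<le> g (inv_word w 0)" by (rule z(2), rule inv_word_in) (use w in auto)
      then have "exp (3 * \<bar>1 + t\<bar>) * word_deriv w 0 powr (1 + t) * 1
          \<le> exp (3 * \<bar>1 + t\<bar>) * word_deriv w 0 powr (1 + t) * (g (inv_word w 0) / g z)"
        using gz by (intro mult_left_mono) auto
      then show "exp (3 * \<bar>1 + t\<bar>) * word_deriv w 0 powr (1 + t)
          \<le> exp (3 * \<bar>1 + t\<bar>) / g z * (word_deriv w 0 powr (1 + t) * g (inv_word w 0))"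
        by simp
    qed
    also have "\<dots> \<le> exp (3 * \<bar>1 + t\<bar>) / g z * (exp \<gamma> ^ n * g 0)"
      unfolding sum_distrib_left[symmetric]
      by (intro mult_left_mono word_sum_le transfer_op_le_of_SUP[OF g sup]) (use gz in auto)
    also have "\<dots> = B * exp (real n * \<gamma>)" by (simp add: B_def exp_of_nat_mult)
    finally have sum: "(\<Sum>w\<in>word n ` space bolyai_acim. acim.pr (word n) w powr (1 + t)) \<le> B * exp (real n * \<gamma>)" .
    have "- t * acim.ent (word n) \<le> ln (B * exp (real n * \<gamma>))"
    proof (rule acim.ent_power_sum_bound[OF sw _ sum])
      fix w assume "w \<in> word n ` space bolyai_acim"
      then have w: "w \<in> words n" using img by blast
      have "0 < exp (- 3) * word_deriv w 0" using wd[OF w] by simp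
      then show "0 < acim.pr (word n) w" using pr_word_bounds(1)[OF w] by linarith
    qed (use B in simp)
    then show ?thesis using B by (simp add: ln_mult)
  qed
  then show ?thesis by (intro exI[of _ "ln B"] allI)
qed

text \<open>This takes the place of the generator theorem: an arbitrary finite partition has little
  entropy given long enough cylinders, so the entropy rate of its itineraries hardly exceeds that of
  the digits.\<close>

lemma ks_entropy_upper:
  assumes bd: "\<And>n. acim.ent (word n) \<le> C + real n * b"
  shows "ks_entropy bolyai_acim bolyai_T \<le> ereal b"
  unfolding ks_entropy_def
proof (rule SUP_least)
  fix Q assume "Q \<in> {P. finite_meas_partition bolyai_acim P}"
  then have Q: "finite_meas_partition bolyai_acim Q" by simp
  define X where "X = acim.atom Q"
  have X: "simple_function bolyai_acim X" unfolding X_def by (rule acim.simple_function_atom[OF Q])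
  define K where "K = card (X ` space bolyai_acim)"
  have "partition_ks_entropy bolyai_acim bolyai_T Q \<le> b + e" if e: "0 < e" for e
  proof -
    \<comment> \<open>Each of the \<open>K\<close> cells costs \<open>3 * \<eta>\<close> in
      \<open>ent_pair_le_of_approx\<close>, and the total has to stay below \<open>e\<close>;
      \<open>Suc K\<close> keeps the divisor positive.\<close>
    define \<eta> where "\<eta> = min 1 (e / (3 * real (Suc K)))"
    have \<eta>: "0 < \<eta>" "\<eta> \<le> 1" using e by (auto simp: \<eta>_def)
    have "real K * (3 * \<eta>) \<le> real (Suc K) * (3 * (e / (3 * real (Suc K))))"
      using e by (intro mult_mono) (auto simp: \<eta>_def)
    also have "\<dots> = e" by (simp add: field_simps)
    finally have K\<eta>: "real K * (3 * \<eta>) \<le> e" .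
    have fin: "finite Q" and QS: "\<And>a. a \<in> Q \<Longrightarrow> a \<in> sets leb01"
      using Q by (auto simp: finite_meas_partition_def)
    \<comment> \<open>Dividing by \<open>exp 2\<close> turns a Lebesgue error into an error at most
      \<open>\<eta>\<^sup>2\<close> for the invariant measure.\<close>
    define P where "P a m W \<longleftrightarrow> measure leb01 {x \<in> {0..1}. (x \<in> a) \<noteq> (word m x \<in> W)} < \<eta>\<^sup>2 / exp 2" for a m W
    have "\<exists>m0. \<forall>m\<ge>m0. \<exists>W. P a m W" if "a \<in> Q" for a
      unfolding P_def by (rule cylinder_approx) (use QS[OF that] \<eta> in \<open>auto simp: sets_leb01_iff\<close>)
    then have "\<forall>a\<in>Q. \<exists>m0. \<forall>m\<ge>m0. \<exists>W. P a m W" by (rule ballI)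
    from bchoice[OF this] obtain m0 where m0: "\<forall>a\<in>Q. \<forall>m\<ge>m0 a. \<exists>W. P a m W" by (elim exE)
    \<comment> \<open>One order must serve all cells; the sum is at least as large as each
      \<open>m0 a\<close>.\<close>
    define m where "m = (\<Sum>a\<in>Q. m0 a)"
    have "m0 a \<le> m" if "a \<in> Q" for a unfolding m_def using fin that by (intro member_le_sum) auto
    with m0 have "\<forall>a\<in>Q. \<exists>W. P a m W" by simp
    from bchoice[OF this] obtain W where "\<forall>a\<in>Q. P a m (W a)" by (elim exE)
    then have W: "measure leb01 {x \<in> {0..1}. (x \<in> a) \<noteq> (word m x \<in> W a)} < \<eta>\<^sup>2 / exp 2" if "a \<in> Q" for a
      using that by (simp add: P_def)
    have "acim.ent (\<lambda>x. (X x, word m x)) \<le> acim.ent (word m) + real (card (X ` space bolyai_acim)) * (3 * \<eta>)"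
    proof (rule acim.ent_pair_le_of_approx[OF X _ \<eta>])
      show "simple_function bolyai_acim (word m)"
        by (rule acim.simple_function_orbit_word[OF simple_function_digit])
      fix a assume "a \<in> X ` space bolyai_acim"
      then have a: "a \<in> Q" using acim.atom_exists(1)[OF Q] by (auto simp: X_def)
      let ?D = "{x \<in> {0..1}. (x \<in> a) \<noteq> (word m x \<in> W a)}"
      have D: "?D \<in> sets leb01" by (rule word_set_measurable) (use QS[OF a] in \<open>simp add: sets_leb01_iff\<close>)
      have "{x \<in> space bolyai_acim. (X x = a) \<noteq> (word m x \<in> W a)} = ?D"
        unfolding X_def using acim.atom_eq_iff[OF Q _ a] by auto
      moreover have "measure bolyai_acim ?D \<le> exp 2 * (\<eta>\<^sup>2 / exp 2)"
        by (rule order_trans[OF measure_bolyai_acim_bounds(2)[OF D]], rule mult_left_mono[OF less_imp_le[OF W[OF a]]]) simp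
      ultimately show "acim.prob {x \<in> space bolyai_acim. (X x = a) \<noteq> (word m x \<in> W a)} \<le> \<eta>\<^sup>2" by simp
    qed
    then have cond: "acim.ent (\<lambda>x. (X x, word m x)) \<le> acim.ent (word m) + e"
      using K\<eta> unfolding K_def by linarith
    \<comment> \<open>The \<open>m\<close> additional letters and the constant \<open>C\<close>
      contribute a term independent of \<open>n\<close>, which vanishes in the average.\<close>
    have le: "acim.ent (orbit_word bolyai_T X (Suc n)) / real (Suc n) \<le> b + e + (C + real m * b) / real (Suc n)" for n
    proof -
      have "acim.ent (orbit_word bolyai_T X (Suc n)) \<le> acim.ent (word (Suc n + m)) + real (Suc n) * e"
        by (rule acim.ent_orbit_word_le[OF X simple_function_digit cond])
      also have "\<dots> \<le> real (Suc n) * (b + e) + (C + real m * b)"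
        using bd[of "Suc n + m"] by (simp add: algebra_simps)
      finally have "acim.ent (orbit_word bolyai_T X (Suc n)) / real (Suc n)
          \<le> (real (Suc n) * (b + e) + (C + real m * b)) / real (Suc n)"
        by (rule divide_right_mono) simp
      then show ?thesis by (simp add: add_divide_distrib)
    qed
    have "(\<lambda>n. b + e + (C + real m * b) / real (Suc n)) \<longlonglongrightarrow> b + e + 0"
      by (intro tendsto_add tendsto_const LIMSEQ_Suc lim_const_over_n)
    then show ?thesis
      using acim.partition_ks_entropy_lim[OF Q] le unfolding X_def[symmetric] by (intro LIMSEQ_le) auto
  qed
  then show "ereal (partition_ks_entropy bolyai_acim bolyai_T Q) \<le> ereal b"
    by (simp add: field_le_epsilon)
qed

text \<open>It is enough to test the supremum on the partition by first digit, whose itineraries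
  determine those of \<open>digit\<close>.\<close>

lemma ks_entropy_lower:
  assumes bd: "\<And>n. C + real n * a \<le> acim.ent (word n)"
  shows "ereal a \<le> ks_entropy bolyai_acim bolyai_T"
proof -
  define Q where "Q = (\<lambda>i. {x \<in> {0..1}. digit x = i}) ` {1, 2, 3}"
  have "{x \<in> {0..1}. digit x = i} \<in> sets leb01" for i
    using simple_functionD(2)[OF simple_function_digit, of "{i}"] by (simp add: vimage_def Int_def conj_commute)
  then have Q: "finite_meas_partition bolyai_acim Q"
    unfolding finite_meas_partition_def Q_def using digit_in by (auto simp: disjoint_def)
  \<comment> \<open>The digit is constant on a cell, so any element chosen from the cell reveals it;
    this makes \<open>digit\<close> a function of the atom.\<close>
  let ?g = "\<lambda>A. digit (SOME y. y \<in> A)"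
  have dg: "digit x = ?g (acim.atom Q x)" if "x \<in> space bolyai_acim" for x
  proof -
    note at = acim.atom_exists[OF Q that]
    obtain i where i: "acim.atom Q x = {x \<in> {0..1}. digit x = i}" using at(1) unfolding Q_def by (elim imageE)
    have "(SOME y. y \<in> acim.atom Q x) \<in> acim.atom Q x" by (rule someI[of "\<lambda>y. y \<in> acim.atom Q x", OF at(2)])
    then have "?g (acim.atom Q x) = i" using i by simp
    moreover have "digit x = i" using at(2) i by simp
    ultimately show ?thesis by simp
  qed
  have le: "a + C / real (Suc n) \<le> acim.ent (orbit_word bolyai_T (acim.atom Q) (Suc n)) / real (Suc n)" for n
  proof -
    have "acim.ent (word (Suc n)) \<le> acim.ent (orbit_word bolyai_T (acim.atom Q) (Suc n))"
    proof (rule acim.ent_le_of_comp[where g="map ?g"])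
      show "simple_function bolyai_acim (orbit_word bolyai_T (acim.atom Q) (Suc n))"
        by (rule acim.simple_function_orbit_word[OF acim.simple_function_atom[OF Q]])
      show "word (Suc n) x = map ?g (orbit_word bolyai_T (acim.atom Q) (Suc n) x)" if "x \<in> space bolyai_acim" for x
        using dg[OF acim.T_space[OF that]] by (simp add: orbit_word_def)
    qed
    then have "(C + real (Suc n) * a) / real (Suc n) \<le> acim.ent (orbit_word bolyai_T (acim.atom Q) (Suc n)) / real (Suc n)"
      using bd[of "Suc n"] by (intro divide_right_mono) auto
    then show ?thesis by (simp add: add_divide_distrib add.commute)
  qed
  have "(\<lambda>n. a + C / real (Suc n)) \<longlonglongrightarrow> a + 0"
    by (intro tendsto_add tendsto_const LIMSEQ_Suc lim_const_over_n)
  then have "a \<le> partition_ks_entropy bolyai_acim bolyai_T Q"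
    using acim.partition_ks_entropy_lim[OF Q] le by (intro LIMSEQ_le) auto
  then show ?thesis unfolding ks_entropy_def using Q by (intro SUP_upper2[of Q]) auto
qed

theorem mainTheorem8:
  fixes \<epsilon> \<alpha> \<beta> :: real and f g :: "real \<Rightarrow> real"
  assumes "\<epsilon> > 0" "\<alpha> > 0" "\<beta> > 0"
    and "continuous_on {0..1} f" "\<forall>x\<in>{0..1}. f x > 0"
    and "continuous_on {0..1} g" "\<forall>x\<in>{0..1}. g x > 0"
    and "(SUP x\<in>{0..1}. transfer_op \<epsilon> g x / g x) \<le> exp (- \<alpha>)"
    and "(SUP x\<in>{0..1}. transfer_op (- \<epsilon>) f x / f x) \<le> exp \<beta>"
  shows "ereal (\<beta> / \<epsilon>) \<ge> ks_entropy bolyai_mu bolyai_T \<and>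
         ks_entropy bolyai_mu bolyai_T \<ge> ereal (\<alpha> / \<epsilon>)"
  unfolding bolyai_mu_eq
proof
  obtain C where C: "\<And>n. - (- \<epsilon>) * acim.ent (word n) \<le> C + real n * \<beta>"
    using ent_word_bound[OF assms(4,5,9)] by blast
  show "ks_entropy bolyai_acim bolyai_T \<le> ereal (\<beta> / \<epsilon>)"
    by (rule ks_entropy_upper[of "C / \<epsilon>"]) (use C assms(1) in \<open>simp add: field_simps\<close>)
  obtain D where D: "\<And>n. - \<epsilon> * acim.ent (word n) \<le> D + real n * - \<alpha>"
    using ent_word_bound[OF assms(6,7,8)] by blast
  show "ereal (\<alpha> / \<epsilon>) \<le> ks_entropy bolyai_acim bolyai_T"
  proof (rule ks_entropy_lower[of "- D / \<epsilon>"])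
    fix n
    have "real n * \<alpha> - D \<le> \<epsilon> * acim.ent (word n)" using D[of n] by simp
    then show "- D / \<epsilon> + real n * (\<alpha> / \<epsilon>) \<le> acim.ent (word n)" using assms(1) by (simp add: field_simps)
  qed
qed

end
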